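(* If $I$ is an $e$-complete ideal and $J$ is a countably generated ideal with $J\subset I$, then there is a principal ideal $L$ with $J\subset L\subset I$. Thus, assuming the continuum hypothesis, every $e$-complete ideal $I$ is the union of an increasing chain of principal ideals.
   Context: $H$ is a separable infinite-dimensional complex Hilbert space. "Ideal" means a nonzero two-sided ideal of $B(H)$ contained in the compact operators. $c_o^*$ is the set of nonnegative monotone nonincreasing sequences converging to $0$; $\Sigma(I):=\{s(X)\mid X\in I\}\subset c_o^*$, where $s(X)$ is the sequence of s-numbers (singular values) of $X$; an ideal is determined by $\Sigma(I)$. A Banach ideal is an ideal complete with respect to a symmetric norm, i.e., a norm with $\|AXB\|\le\|A\|_{B(H)}\|X\|\|B\|_{B(H)}$ for $X$ in the ideal and $A,B\in B(H)$. For $p>0$, $J^p$ is the ideal with $\Sigma(J^p)=\{\xi^p\mid\xi\in\Sigma(J)\}$. An ideal is $e$-complete if it is a power of a Banach ideal, i.e., of the form $J^p$ for some $p>0$ and some Banach ideal $J$. A principal ideal is one generated by a single operator; a countably generated ideal is one generated by a countable set of operators. An increasing chain of ideals is a (possibly uncountable) family of ideals totally ordered by inclusion. *)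

theory Defs
  imports "HOL-Analysis.Analysis" "HOL-Library.Equipollence"
begin

section \<open>Complex Hilbert spaces\<close>

text \<open>The norm, the topology and the real scalar multiplication are those of the underlying
  real inner product, which is the real part of the complex one. The complex inner product is
  linear in its first argument; its positive definiteness and \<open>\<parallel>x\<parallel>\<^sup>2 = \<langle>x, x\<rangle>\<close> are inherited from
  \<^class>\<open>real_inner\<close>.\<close>

class complex_hilbert_space = real_inner + complete_space +
  fixes scaleC :: "complex \<Rightarrow> 'a \<Rightarrow> 'a"  (infixr "*\<^sub>C" 75)
    and cinner :: "'a \<Rightarrow> 'a \<Rightarrow> complex"
  assumes scaleC_add_right: "a *\<^sub>C (x + y) = a *\<^sub>C x + a *\<^sub>C y"
    and scaleC_add_left: "(a + b) *\<^sub>C x = a *\<^sub>C x + b *\<^sub>C x"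
    and scaleC_scaleC: "a *\<^sub>C (b *\<^sub>C x) = (a * b) *\<^sub>C x"
    and scaleC_one: "1 *\<^sub>C x = x"
    and scaleR_scaleC: "r *\<^sub>R x = complex_of_real r *\<^sub>C x"
    and cinner_add_left: "cinner (x + y) z = cinner x z + cinner y z"
    and cinner_scaleC_left: "cinner (a *\<^sub>C x) y = a * cinner x y"
    and cinner_commute: "cinner x y = cnj (cinner y x)"
    and Re_cinner: "Re (cinner x y) = inner x y"

global_interpretation complex_vector: vector_space
  "scaleC :: complex \<Rightarrow> 'a \<Rightarrow> 'a::complex_hilbert_space"
  by unfold_locales
    (simp_all add: scaleC_add_right scaleC_add_left scaleC_scaleC scaleC_one)

lemma norm_scaleC: "norm (a *\<^sub>C x) = cmod a * norm (x :: 'a::complex_hilbert_space)"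
proof -
  have right: "cinner (a *\<^sub>C x) (a *\<^sub>C x) = (a * cnj a) * cinner x x"
    by (metis cinner_commute cinner_scaleC_left complex_cnj_mult mult.assoc)
  have "(norm (a *\<^sub>C x))\<^sup>2 = Re (cinner (a *\<^sub>C x) (a *\<^sub>C x))"
    by (simp add: Re_cinner power2_norm_eq_inner)
  also have "\<dots> = (cmod a)\<^sup>2 * Re (cinner x x)"
    unfolding right by (simp add: complex_norm_square [symmetric] flip: of_real_power)
  also have "\<dots> = (cmod a * norm x)\<^sup>2"
    by (simp add: Re_cinner power2_norm_eq_inner power_mult_distrib)
  finally show ?thesis by (simp add: power2_eq_iff_nonneg)
qed

section \<open>Bounded operators and ideals\<close>

text \<open>\<open>'a \<Rightarrow>\<^sub>L 'a\<close> is the space of real-linear bounded maps; \<open>B(H)\<close> is its subset of complex-linear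
  ones. The norm on \<open>'a \<Rightarrow>\<^sub>L 'a\<close> is the operator norm.\<close>

definition BH :: "('a::complex_hilbert_space \<Rightarrow>\<^sub>L 'a) set"
  where "BH = {A :: 'a \<Rightarrow>\<^sub>L 'a. \<forall>c x. A (c *\<^sub>C x) = c *\<^sub>C A x}"

lift_definition cscale_op ::
  "complex \<Rightarrow> ('a::complex_hilbert_space \<Rightarrow>\<^sub>L 'a) \<Rightarrow> ('a \<Rightarrow>\<^sub>L 'a)"
  is "\<lambda>c A x. c *\<^sub>C A x"
proof -
  fix c :: complex and A :: "'a \<Rightarrow> 'a"
  assume A: "bounded_linear A"
  have "bounded_linear (\<lambda>x::'a. c *\<^sub>C x)"
    by (rule bounded_linear_intro [where K = "cmod c"])
      (simp_all add: scaleC_add_right scaleR_scaleC scaleC_scaleC norm_scaleC mult.commute)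
  from bounded_linear_compose [OF this A] show "bounded_linear (\<lambda>x. c *\<^sub>C A x)" .
qed

definition cadjoint :: "('a::complex_hilbert_space \<Rightarrow>\<^sub>L 'a) \<Rightarrow> ('a \<Rightarrow>\<^sub>L 'a)"
  where "cadjoint A = (THE B. B \<in> BH \<and> (\<forall>x y. cinner (A x) y = cinner x (B y)))"

definition compact_op :: "('a::complex_hilbert_space \<Rightarrow>\<^sub>L 'a) \<Rightarrow> bool"
  where "compact_op A \<longleftrightarrow> A \<in> BH \<and> compact (closure (blinfun_apply A ` cball 0 1))"

definition two_sided_ideal :: "('a::complex_hilbert_space \<Rightarrow>\<^sub>L 'a) set \<Rightarrow> bool"
  where "two_sided_ideal I \<longleftrightarrow> I \<subseteq> BH \<and> 0 \<in> I \<and> (\<forall>X\<in>I. \<forall>Y\<in>I. X + Y \<in> I) \<and>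
    (\<forall>A\<in>BH. \<forall>X\<in>I. A o\<^sub>L X \<in> I \<and> X o\<^sub>L A \<in> I)"

definition op_ideal :: "('a::complex_hilbert_space \<Rightarrow>\<^sub>L 'a) set \<Rightarrow> bool"
  where "op_ideal I \<longleftrightarrow> two_sided_ideal I \<and> I \<noteq> {0} \<and> (\<forall>X\<in>I. compact_op X)"

definition principal_ideal :: "('a::complex_hilbert_space \<Rightarrow>\<^sub>L 'a) set \<Rightarrow> bool"
  where "principal_ideal I \<longleftrightarrow> op_ideal I \<and> (\<exists>X\<in>BH. I = two_sided_ideal hull {X})"

definition countably_generated_ideal :: "('a::complex_hilbert_space \<Rightarrow>\<^sub>L 'a) set \<Rightarrow> bool"
  where "countably_generated_ideal I \<longleftrightarrow>
    op_ideal I \<and> (\<exists>S\<subseteq>BH. countable S \<and> I = two_sided_ideal hull S)"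

section \<open>Singular values and characteristic sets\<close>

definition c0_star :: "(nat \<Rightarrow> real) set"
  where "c0_star = {\<xi>. (\<forall>n. 0 \<le> \<xi> n) \<and> decseq \<xi> \<and> \<xi> \<longlonglongrightarrow> 0}"

text \<open>The singular values of a compact operator \<open>X\<close> are the square roots of the eigenvalues of
  \<open>X\<^sup>* X\<close>, listed in nonincreasing order, each positive value as often as its (finite)
  multiplicity, and padded with zeros if there are only finitely many positive ones. Prescribing
  how often each positive value occurs determines a sequence in \<^const>\<open>c0_star\<close> uniquely.\<close>

definition s_numbers :: "('a::complex_hilbert_space \<Rightarrow>\<^sub>L 'a) \<Rightarrow> nat \<Rightarrow> real"
  where "s_numbers X = (THE s. s \<in> c0_star \<and>
    (\<forall>t>0. card {n. s n = t} =
       complex_vector.dim {x. (cadjoint X o\<^sub>L X) x = complex_of_real (t\<^sup>2) *\<^sub>C x}))"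

definition characteristic_set :: "('a::complex_hilbert_space \<Rightarrow>\<^sub>L 'a) set \<Rightarrow> (nat \<Rightarrow> real) set"
  where "characteristic_set I = s_numbers ` I"

section \<open>Banach ideals and their powers\<close>

text \<open>Only the values of \<open>N\<close> on \<open>I\<close> matter.\<close>

definition symmetric_norm_on ::
  "('a::complex_hilbert_space \<Rightarrow>\<^sub>L 'a) set \<Rightarrow> (('a \<Rightarrow>\<^sub>L 'a) \<Rightarrow> real) \<Rightarrow> bool"
  where "symmetric_norm_on I N \<longleftrightarrow>
    (\<forall>X\<in>I. 0 \<le> N X \<and> (N X = 0 \<longleftrightarrow> X = 0)) \<and>
    (\<forall>X\<in>I. \<forall>c. N (cscale_op c X) = cmod c * N X) \<and>
    (\<forall>X\<in>I. \<forall>Y\<in>I. N (X + Y) \<le> N X + N Y) \<and>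
    (\<forall>X\<in>I. \<forall>A\<in>BH. \<forall>B\<in>BH. N (A o\<^sub>L X o\<^sub>L B) \<le> norm A * N X * norm B)"

definition norm_complete_on ::
  "('a::complex_hilbert_space \<Rightarrow>\<^sub>L 'a) set \<Rightarrow> (('a \<Rightarrow>\<^sub>L 'a) \<Rightarrow> real) \<Rightarrow> bool"
  where "norm_complete_on I N \<longleftrightarrow>
    (\<forall>\<sigma>. range \<sigma> \<subseteq> I \<and> (\<forall>e>0. \<exists>M::nat. \<forall>m\<ge>M. \<forall>n\<ge>M. N (\<sigma> m - \<sigma> n) < e) \<longrightarrow>
      (\<exists>X\<in>I. (\<lambda>n. N (\<sigma> n - X)) \<longlonglongrightarrow> 0))"

definition banach_ideal :: "('a::complex_hilbert_space \<Rightarrow>\<^sub>L 'a) set \<Rightarrow> bool"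
  where "banach_ideal I \<longleftrightarrow>
    op_ideal I \<and> (\<exists>N. symmetric_norm_on I N \<and> norm_complete_on I N)"

text \<open>An ideal is determined by its characteristic set, so the power \<open>J\<^sup>p\<close> is rendered as the
  relation ``\<open>I\<close> is the ideal \<open>J\<^sup>p\<close>''.\<close>

definition is_ideal_power ::
  "('a::complex_hilbert_space \<Rightarrow>\<^sub>L 'a) set \<Rightarrow> ('a \<Rightarrow>\<^sub>L 'a) set \<Rightarrow> real \<Rightarrow> bool"
  where "is_ideal_power I J p \<longleftrightarrow>
    op_ideal I \<and> characteristic_set I = (\<lambda>\<xi> n. \<xi> n powr p) ` characteristic_set J"

definition e_complete :: "('a::complex_hilbert_space \<Rightarrow>\<^sub>L 'a) set \<Rightarrow> bool"
  where "e_complete I \<longleftrightarrow> (\<exists>J p. banach_ideal J \<and> p > 0 \<and> is_ideal_power I J p)"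

section \<open>The continuum hypothesis\<close>

definition continuum_hypothesis :: bool
  where "continuum_hypothesis \<longleftrightarrow> (\<forall>S :: real set. countable S \<or> S \<approx> (UNIV :: real set))"

end

(* By the singular value decomposition an ideal contains a compact operator exactly when it contains
   the diagonal operator of its singular values, so an ideal can be handled through sequences.
   If I = K^p with K a Banach ideal and X_0, X_1, ... generate J, write s(X_k) = xi_k^p with xi_k in
   the characteristic set of K. The normalised sum eta = sum_k c_k xi_k converges in the norm of K,
   hence diag eta lies in K, and an operator Y in I with s(Y) = eta^p dominates every X_k, up to
   constants, because eta >= c_k xi_k. So Y generates the required principal ideal.
   There are at most continuum many principal ideals, each being generated by the diagonal operator
   of a real sequence. Under the continuum hypothesis those inside I can therefore be well-ordered
   with countable initial segments, and the first part provides upper bounds along this order. *)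

theory Submission
  imports Defs
begin

text \<open>Singular values are not additive, so a sum of the sequences xi_k says nothing about
  operators until all of them act along one common orthonormal sequence. What permits this move is a
  factorisation (\<open>ideal_diag_op_dominated\<close>): multiplying by bounded diagonal operators
  on both sides carries a diagonal operator to any other pair of orthonormal sequences and shrinks
  its coefficients at will. The order of the operations also matters. Pointwise domination survives
  the passage to p-th powers, with \<open>C\<close> replaced by \<open>C powr p\<close>, while sums
  do not; so the summation takes place in K and the exponent is applied afterwards. Completeness of
  K supplies only an abstract limit operator. A symmetric norm dominates the operator norm up to a
  constant, hence the diagonal coefficients converge uniformly, and a uniform limit of nonincreasing
  null sequences is again one.\<close>

instance complex_hilbert_space \<subseteq> banach ..

section \<open>Orthonormal families\<close>

lemma cinner_add_right: "cinner x (y + z) = cinner x y + cinner x (z::'a::complex_hilbert_space)"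
  by (subst (1 2 3) cinner_commute) (simp add: cinner_add_left)

lemma cinner_scaleC_right: "cinner x (a *\<^sub>C y) = cnj a * cinner x (y::'a::complex_hilbert_space)"
  by (subst (1 2) cinner_commute) (simp add: cinner_scaleC_left)

lemma cinner_zero_left [simp]: "cinner 0 (x::'a::complex_hilbert_space) = 0"
  using cinner_add_left[of 0 0 x] by simp

lemma cinner_minus_left: "cinner (- x) y = - cinner x (y::'a::complex_hilbert_space)"
  using cinner_add_left[of x "- x" y] by (simp add: eq_neg_iff_add_eq_0 add.commute)

lemma cinner_diff_left: "cinner (x - y) z = cinner x z - cinner y (z::'a::complex_hilbert_space)"
  using cinner_add_left[of x "- y" z] by (simp add: cinner_minus_left)

lemma cinner_diff_right: "cinner x (y - z) = cinner x y - cinner x (z::'a::complex_hilbert_space)"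
  by (subst (1 2 3) cinner_commute) (simp add: cinner_diff_left)

lemma cinner_sum_left:
  "cinner (\<Sum>i\<in>A. f i) (y::'a::complex_hilbert_space) = (\<Sum>i\<in>A. cinner (f i) y)"
  by (induction A rule: infinite_finite_induct) (simp_all add: cinner_add_left)

lemma cinner_self: "cinner x x = complex_of_real ((norm (x::'a::complex_hilbert_space))\<^sup>2)"
proof (rule complex_eqI)
  show "Re (cinner x x) = Re (complex_of_real ((norm x)\<^sup>2))"
    by (simp add: Re_cinner power2_norm_eq_inner)
  have "Im (cinner x x) = Im (cnj (cinner x x))"
    by (subst cinner_commute) simp
  then show "Im (cinner x x) = Im (complex_of_real ((norm x)\<^sup>2))" by simp
qed

lemma cmod_cinner_le: "cmod (cinner x y) \<le> norm x * norm (y::'a::complex_hilbert_space)"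
proof (cases "cinner x y = 0")
  case False
  \<comment> \<open>A unimodular factor that turns the inner product into a nonnegative real, so
    that the real Cauchy-Schwarz inequality for \<open>inner\<close> applies.\<close>
  define w where "w = cnj (sgn (cinner x y))"
  have w: "cmod w = 1" using False by (simp add: w_def norm_sgn)
  have "w * cinner x y = complex_of_real (cmod (cinner x y))"
    unfolding w_def sgn_eq using False complex_norm_square[of "cinner x y"]
    by (simp add: field_simps power2_eq_square)
  then have "cmod (cinner x y) = Re (cinner (w *\<^sub>C x) y)"
    by (simp add: cinner_scaleC_left)
  also have "\<dots> \<le> norm (w *\<^sub>C x) * norm y"
    by (simp add: Re_cinner norm_cauchy_schwarz)
  finally show ?thesis by (simp add: norm_scaleC w)
qed simp

lemma cinner_scaleR_left: "cinner (r *\<^sub>R x) y = complex_of_real r * cinner x (y::'a::complex_hilbert_space)"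
  by (simp add: scaleR_scaleC cinner_scaleC_left)

lemma bounded_linear_cinner_left: "bounded_linear (\<lambda>x. cinner x (y::'a::complex_hilbert_space))"
  by (rule bounded_linear_intro [where K = "norm y"])
    (simp_all add: cinner_add_left cinner_scaleR_left scaleR_conv_of_real cmod_cinner_le)

lemma bounded_linear_scaleC_right: "bounded_linear (\<lambda>x::'a::complex_hilbert_space. c *\<^sub>C x)"
  by (rule bounded_linear_intro [where K = "cmod c"])
    (simp_all add: scaleC_add_right scaleR_scaleC scaleC_scaleC norm_scaleC mult.commute)

section \<open>Finite orthonormal families: Pythagoras and Bessel\<close>

definition orthonormal_on :: "'i set \<Rightarrow> ('i \<Rightarrow> 'a::complex_hilbert_space) \<Rightarrow> bool"
  where "orthonormal_on A e \<longleftrightarrow> (\<forall>m\<in>A. \<forall>n\<in>A. cinner (e m) (e n) = (if m = n then 1 else 0))"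

lemma orthonormal_onD:
  "orthonormal_on A e \<Longrightarrow> m \<in> A \<Longrightarrow> n \<in> A \<Longrightarrow> cinner (e m) (e n) = (if m = n then 1 else 0)"
  by (auto simp: orthonormal_on_def)

lemma orthonormal_on_subset: "orthonormal_on A e \<Longrightarrow> B \<subseteq> A \<Longrightarrow> orthonormal_on B e"
  unfolding orthonormal_on_def by blast

lemma orthonormal_norm: "orthonormal_on A e \<Longrightarrow> n \<in> A \<Longrightarrow> norm (e n) = 1"
  using orthonormal_onD[of A e n n] unfolding cinner_self
  by (simp add: power2_eq_1_iff flip: of_real_power) (smt (verit) norm_ge_zero)

lemma orthonormal_cinner_sum:
  assumes "orthonormal_on A e" "finite A" "k \<in> A"
  shows "cinner (\<Sum>n\<in>A. c n *\<^sub>C e n) (e k) = c k"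
proof -
  have "cinner (\<Sum>n\<in>A. c n *\<^sub>C e n) (e k) = (\<Sum>n\<in>A. if n = k then c n else 0)"
    unfolding cinner_sum_left cinner_scaleC_left
    by (rule sum.cong) (auto simp: orthonormal_onD[OF assms(1)] assms)
  then show ?thesis using assms by simp
qed

lemma orthonormal_norm_sum:
  assumes "orthonormal_on A e" "finite A"
  shows "(norm (\<Sum>n\<in>A. c n *\<^sub>C e n))\<^sup>2 = (\<Sum>n\<in>A. (cmod (c n))\<^sup>2)"
proof -
  let ?y = "\<Sum>n\<in>A. c n *\<^sub>C e n"
  have "cinner ?y ?y = (\<Sum>n\<in>A. c n * cinner (e n) ?y)"
    by (subst cinner_sum_left) (simp add: cinner_scaleC_left)
  also have "\<dots> = (\<Sum>n\<in>A. c n * cnj (c n))"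
    by (intro sum.cong refl, subst cinner_commute) (simp add: orthonormal_cinner_sum[OF assms])
  also have "\<dots> = complex_of_real (\<Sum>n\<in>A. (cmod (c n))\<^sup>2)"
    by (simp only: of_real_sum complex_norm_square)
  finally show ?thesis unfolding cinner_self of_real_eq_iff .
qed

lemma orthonormal_residual:
  assumes "orthonormal_on A e" "finite A" "k \<in> A"
  shows "cinner (x - (\<Sum>n\<in>A. cinner x (e n) *\<^sub>C e n)) (e k) = 0"
  by (simp add: cinner_diff_left orthonormal_cinner_sum[OF assms])

lemma orthonormal_residual_norm:
  assumes "orthonormal_on A e" "finite A"
  shows "(norm (x - (\<Sum>n\<in>A. cinner x (e n) *\<^sub>C e n)))\<^sup>2 + (\<Sum>n\<in>A. (cmod (cinner x (e n)))\<^sup>2) = (norm x)\<^sup>2"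
proof -
  let ?y = "\<Sum>n\<in>A. cinner x (e n) *\<^sub>C e n"
  have "cinner ?y (x - ?y) = (\<Sum>n\<in>A. cinner x (e n) * cinner (e n) (x - ?y))"
    by (subst cinner_sum_left) (simp add: cinner_scaleC_left)
  also have "\<dots> = 0"
  proof (intro sum.neutral ballI)
    fix n assume "n \<in> A"
    then have "cinner (e n) (x - ?y) = 0"
      by (subst cinner_commute) (simp add: orthonormal_residual[OF assms])
    then show "cinner x (e n) * cinner (e n) (x - ?y) = 0" by simp
  qed
  finally have "?y \<bullet> (x - ?y) = 0" by (simp add: Re_cinner [symmetric])
  then have "(norm ((x - ?y) + ?y))\<^sup>2 = (norm (x - ?y))\<^sup>2 + (norm ?y)\<^sup>2"
    by (intro norm_add_Pythagorean) (simp add: orthogonal_def inner_commute)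
  then show ?thesis using orthonormal_norm_sum[OF assms] by simp
qed

lemma Bessel:
  assumes "orthonormal_on A e" "finite A"
  shows "(\<Sum>n\<in>A. (cmod (cinner x (e n)))\<^sup>2) \<le> (norm x)\<^sup>2"
  using orthonormal_residual_norm[OF assms, of x] by (smt (verit) zero_le_power2)

section \<open>Square-summable series along orthonormal sequences\<close>

lemma summable_cinner_orthonormal:
  fixes e :: "nat \<Rightarrow> 'a::complex_hilbert_space"
  assumes "orthonormal_on UNIV e"
  shows "summable (\<lambda>n. (cmod (cinner x (e n)))\<^sup>2)"
    and "(\<Sum>n. (cmod (cinner x (e n)))\<^sup>2) \<le> (norm x)\<^sup>2"
proof -
  have b: "(\<Sum>n<N. (cmod (cinner x (e n)))\<^sup>2) \<le> (norm x)\<^sup>2" for N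
    by (intro Bessel orthonormal_on_subset[OF assms]) auto
  show *: "summable (\<lambda>n. (cmod (cinner x (e n)))\<^sup>2)"
    by (rule summableI_nonneg_bounded[OF _ b]) simp
  show "(\<Sum>n. (cmod (cinner x (e n)))\<^sup>2) \<le> (norm x)\<^sup>2"
    by (rule suminf_le_const[OF * b])
qed

text \<open>Riesz-Fischer: by Pythagoras the squared norm of every block of the series equals the
  block of the coefficient series, so one is Cauchy when the other is.\<close>

lemma orthonormal_series:
  fixes e :: "nat \<Rightarrow> 'a::complex_hilbert_space"
  assumes e: "orthonormal_on UNIV e" and c: "summable (\<lambda>n. (cmod (c n))\<^sup>2)"
  shows "summable (\<lambda>n. c n *\<^sub>C e n)"
    and "(norm (\<Sum>n. c n *\<^sub>C e n))\<^sup>2 \<le> (\<Sum>n. (cmod (c n))\<^sup>2)"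
    and "cinner (\<Sum>n. c n *\<^sub>C e n) (e k) = c k"
proof -
  have n2: "(norm (\<Sum>n\<in>A. c n *\<^sub>C e n))\<^sup>2 = (\<Sum>n\<in>A. (cmod (c n))\<^sup>2)" if "finite A" for A
    by (intro orthonormal_norm_sum orthonormal_on_subset[OF e] that) auto
  show s: "summable (\<lambda>n. c n *\<^sub>C e n)"
    unfolding summable_Cauchy
  proof (intro allI impI)
    fix \<epsilon> :: real assume "\<epsilon> > 0"
    then have "\<epsilon>\<^sup>2 > 0" by simp
    then obtain N where N: "norm (\<Sum>n\<in>{m..<k}. (cmod (c n))\<^sup>2) < \<epsilon>\<^sup>2" if "m \<ge> N" for m k
      using c unfolding summable_Cauchy by blast
    show "\<exists>N. \<forall>m\<ge>N. \<forall>k. norm (\<Sum>n\<in>{m..<k}. c n *\<^sub>C e n) < \<epsilon>"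
    proof (intro exI allI impI)
      fix m k assume "m \<ge> N"
      then have "(norm (\<Sum>n\<in>{m..<k}. c n *\<^sub>C e n))\<^sup>2 < \<epsilon>\<^sup>2"
        using N[of m k] by (simp add: n2)
      then show "norm (\<Sum>n\<in>{m..<k}. c n *\<^sub>C e n) < \<epsilon>"
        using \<open>\<epsilon> > 0\<close> power_less_imp_less_base[of _ 2 \<epsilon>] by simp
    qed
  qed
  have lim: "(\<lambda>N. \<Sum>n<N. c n *\<^sub>C e n) \<longlonglongrightarrow> (\<Sum>n. c n *\<^sub>C e n)"
    using summable_LIMSEQ[OF s] .
  have le: "(norm (\<Sum>n<N. c n *\<^sub>C e n))\<^sup>2 \<le> (\<Sum>n. (cmod (c n))\<^sup>2)" for N
    by (simp add: n2 sum_le_suminf[OF c])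
  show "(norm (\<Sum>n. c n *\<^sub>C e n))\<^sup>2 \<le> (\<Sum>n. (cmod (c n))\<^sup>2)"
    by (rule LIMSEQ_le_const2[OF tendsto_power[OF tendsto_norm[OF lim]]]) (use le in blast)
  have "(\<lambda>N. cinner (\<Sum>n<N. c n *\<^sub>C e n) (e k)) \<longlonglongrightarrow> cinner (\<Sum>n. c n *\<^sub>C e n) (e k)"
    by (rule bounded_linear.tendsto[OF bounded_linear_cinner_left lim])
  moreover have "(\<lambda>N. cinner (\<Sum>n<N. c n *\<^sub>C e n) (e k)) \<longlonglongrightarrow> c k"
  proof (rule tendsto_eventually, rule eventually_sequentiallyI[of "Suc k"])
    fix N assume "N \<ge> Suc k"
    then show "cinner (\<Sum>n<N. c n *\<^sub>C e n) (e k) = c k"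
      by (intro orthonormal_cinner_sum orthonormal_on_subset[OF e]) auto
  qed
  ultimately show "cinner (\<Sum>n. c n *\<^sub>C e n) (e k) = c k"
    using LIMSEQ_unique by blast
qed

section \<open>Independence, extension and recursive choice of orthonormal vectors\<close>

lemma orthonormal_independent:
  assumes "orthonormal_on A e" "finite A"
  shows "inj_on e A" "complex_vector.independent (e ` A)"
proof -
  show inj: "inj_on e A"
    unfolding inj_on_def using orthonormal_onD[OF assms(1)] by (metis zero_neq_one)
  show "complex_vector.independent (e ` A)"
  proof (rule complex_vector.independent_if_scalars_zero)
    fix f x assume s: "(\<Sum>x\<in>e ` A. f x *\<^sub>C x) = 0" and "x \<in> e ` A"
    then obtain k where k: "k \<in> A" "x = e k" by blast
    have "(\<Sum>n\<in>A. f (e n) *\<^sub>C e n) = 0"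
      using s by (simp add: sum.reindex[OF inj])
    then have "cinner (\<Sum>n\<in>A. f (e n) *\<^sub>C e n) (e k) = 0" by simp
    then show "f x = 0"
      using orthonormal_cinner_sum[OF assms k(1), of "f \<circ> e"] k by simp
  qed (use assms in simp)
qed

text \<open>One Gram-Schmidt step, applied to any vector outside the span. Every later appeal to
  infinite dimension goes through this lemma.\<close>

lemma orthonormal_extend:
  fixes e :: "'i \<Rightarrow> 'a::complex_hilbert_space"
  assumes inf: "\<not> (\<exists>B :: 'a set. finite B \<and> complex_vector.span B = UNIV)"
    and e: "orthonormal_on A e" "finite A"
  shows "\<exists>v. norm v = 1 \<and> (\<forall>n\<in>A. cinner v (e n) = 0)"
proof -
  obtain x where x: "x \<notin> complex_vector.span (e ` A)"
    using inf e(2) by blast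
  define y where "y = x - (\<Sum>n\<in>A. cinner x (e n) *\<^sub>C e n)"
  have "(\<Sum>n\<in>A. cinner x (e n) *\<^sub>C e n) \<in> complex_vector.span (e ` A)"
    by (intro complex_vector.span_sum complex_vector.span_scale complex_vector.span_base) auto
  then have "y \<noteq> 0" using x by (auto simp: y_def)
  moreover have "cinner y (e n) = 0" if "n \<in> A" for n
    using orthonormal_residual[OF e that] by (simp add: y_def)
  ultimately show ?thesis
    by (intro exI[of _ "complex_of_real (1 / norm y) *\<^sub>C y"])
      (simp add: norm_scaleC cinner_scaleC_left norm_divide)
qed

lemma orthonormal_on_lessThan_Suc:
  fixes f :: "nat \<Rightarrow> 'a::complex_hilbert_space"
  assumes "orthonormal_on {..<n} f" "norm (f n) = 1" "\<And>m. m < n \<Longrightarrow> cinner (f n) (f m) = 0"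
  shows "orthonormal_on {..<Suc n} f"
proof -
  have "cinner (f m) (f n) = 0" if "m < n" for m
    by (subst cinner_commute) (simp add: assms that)
  moreover have "cinner (f n) (f n) = 1"
    using assms(2) by (simp add: cinner_self)
  ultimately show ?thesis
    using assms by (auto simp: orthonormal_on_def less_Suc_eq)
qed

lemma orthonormal_on_UNIV_nat:
  assumes "\<And>n. orthonormal_on {..<n} f"
  shows "orthonormal_on (UNIV :: nat set) f"
  unfolding orthonormal_on_def
proof (intro ballI)
  fix m n show "cinner (f m) (f n) = (if m = n then 1 else 0)"
    using assms[of "Suc (max m n)"] by (rule orthonormal_onD) auto
qed

text \<open>Recursive choice with memory: \<open>Q n f v\<close> may refer to the vectors chosen
  before stage n, and \<open>cong\<close> says that it sees nothing else of \<open>f\<close>. In the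
  singular value decomposition \<open>Q\<close> demands maximality for the right singular vectors
  and prescribes the left ones wherever the singular value is positive.\<close>

lemma orthonormal_seq_choice:
  fixes Q :: "nat \<Rightarrow> (nat \<Rightarrow> 'a::complex_hilbert_space) \<Rightarrow> 'a \<Rightarrow> bool"
  assumes ext: "\<And>f n. orthonormal_on {..<n} f \<Longrightarrow> (\<And>m. m < n \<Longrightarrow> Q m f (f m)) \<Longrightarrow>
      \<exists>v. norm v = 1 \<and> (\<forall>m<n. cinner v (f m) = 0) \<and> Q n f v"
    and cong: "\<And>f g n v. (\<And>m. m < n \<Longrightarrow> f m = g m) \<Longrightarrow> Q n f v = Q n g v"
  obtains e where "orthonormal_on UNIV e" "\<And>n. Q n e (e n)"
proof -
  define P where "P f n v \<longleftrightarrow> norm v = 1 \<and> (\<forall>m<n. cinner v (f m) = 0) \<and> Q n f v"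
    for f n v
  have ortho: "orthonormal_on {..<n} f" if "\<And>m. m < n \<Longrightarrow> P f m (f m)" for f n
    using that
  proof (induction n)
    case (Suc n)
    then have "orthonormal_on {..<n} f" "P f n (f n)" by auto
    then show ?case
      by (intro orthonormal_on_lessThan_Suc) (auto simp: P_def)
  qed (simp add: orthonormal_on_def)
  have "\<exists>e. \<forall>n. P e n (e n)"
  proof (rule dependent_wellorder_choice)
    fix r :: 'a and f g :: "nat \<Rightarrow> 'a" and n assume *: "\<And>m. m < n \<Longrightarrow> f m = g m"
    then show "P f n r = P g n r"
      using cong[OF *] by (auto simp: P_def)
  next
    fix n and f :: "nat \<Rightarrow> 'a" assume *: "\<And>m. m < n \<Longrightarrow> P f m (f m)"
    then have "\<And>m. m < n \<Longrightarrow> Q m f (f m)" by (simp add: P_def)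
    with ext[OF ortho[OF *]] show "\<exists>v. P f n v" by (simp add: P_def)
  qed
  then obtain e where e: "\<And>n. P e n (e n)" by blast
  show thesis
  proof
    show "orthonormal_on UNIV e" by (intro orthonormal_on_UNIV_nat ortho e)
    show "Q n e (e n)" for n using e by (simp add: P_def)
  qed
qed

lemma orthonormal_seq_exists:
  assumes "\<not> (\<exists>B :: 'a set. finite B \<and> complex_vector.span B = UNIV)"
  obtains b :: "nat \<Rightarrow> 'a::complex_hilbert_space" where "orthonormal_on UNIV b"
proof (rule orthonormal_seq_choice[of "\<lambda>_ _ _. True"])
  fix f :: "nat \<Rightarrow> 'a" and n assume "orthonormal_on {..<n} f"
  from orthonormal_extend[OF assms this]
  show "\<exists>v. norm v = 1 \<and> (\<forall>m<n. cinner v (f m) = 0) \<and> True" by auto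
qed (use that in auto)

section \<open>Operators that are diagonal with respect to two orthonormal sequences\<close>

text \<open>The Schmidt form. Two sequences are allowed because a general compact operator maps one
  orthonormal system to multiples of another; neither has to be complete.\<close>

definition diag_op ::
  "(nat \<Rightarrow> real) \<Rightarrow> (nat \<Rightarrow> 'a::complex_hilbert_space) \<Rightarrow> (nat \<Rightarrow> 'a) \<Rightarrow> ('a \<Rightarrow>\<^sub>L 'a)"
  where "diag_op s e f = Blinfun (\<lambda>x. \<Sum>n. (complex_of_real (s n) * cinner x (e n)) *\<^sub>C f n)"

lemma diag_coeff_summable:
  fixes e :: "nat \<Rightarrow> 'a::complex_hilbert_space"
  assumes e: "orthonormal_on UNIV e" and s: "\<forall>n. \<bar>s n\<bar> \<le> K"
  shows "summable (\<lambda>n. (cmod (complex_of_real (s n) * cinner x (e n)))\<^sup>2)"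
    and "(\<Sum>n. (cmod (complex_of_real (s n) * cinner x (e n)))\<^sup>2) \<le> (K * norm x)\<^sup>2"
proof -
  have sum: "summable (\<lambda>n. K\<^sup>2 * (cmod (cinner x (e n)))\<^sup>2)"
    by (intro summable_mult summable_cinner_orthonormal e)
  have le: "(cmod (complex_of_real (s n) * cinner x (e n)))\<^sup>2 \<le> K\<^sup>2 * (cmod (cinner x (e n)))\<^sup>2" for n
    using power_mono[OF s[rule_format, of n], of 2]
    by (simp add: norm_mult power_mult_distrib mult_right_mono)
  show 1: "summable (\<lambda>n. (cmod (complex_of_real (s n) * cinner x (e n)))\<^sup>2)"
    by (rule summable_comparison_test'[OF sum]) (use le in auto)
  have "(\<Sum>n. (cmod (complex_of_real (s n) * cinner x (e n)))\<^sup>2) \<le> (\<Sum>n. K\<^sup>2 * (cmod (cinner x (e n)))\<^sup>2)"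
    by (rule suminf_le[OF le 1 sum])
  also have "\<dots> \<le> (K * norm x)\<^sup>2"
    by (simp add: suminf_mult summable_cinner_orthonormal[OF e] power_mult_distrib mult_left_mono)
  finally show "(\<Sum>n. (cmod (complex_of_real (s n) * cinner x (e n)))\<^sup>2) \<le> (K * norm x)\<^sup>2" .
qed

lemma diag_op_series:
  fixes e f :: "nat \<Rightarrow> 'a::complex_hilbert_space"
  assumes e: "orthonormal_on UNIV e" and f: "orthonormal_on UNIV f" and s: "\<forall>n. \<bar>s n\<bar> \<le> K"
  shows "(\<lambda>n. (complex_of_real (s n) * cinner x (e n)) *\<^sub>C f n) sums diag_op s e f x"
    and "cinner (diag_op s e f x) (f k) = complex_of_real (s k) * cinner x (e k)"
    and "norm (diag_op s e f x) \<le> K * norm x"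
    and "diag_op s e f \<in> BH"
proof -
  \<comment> \<open>Linearity and boundedness are proved for the bare function, since
    \<open>Blinfun\<close> is specified only on bounded linear maps.\<close>
  define g where "g x = (\<Sum>n. (complex_of_real (s n) * cinner x (e n)) *\<^sub>C f n)" for x
  have K: "K \<ge> 0" using s[rule_format, of 0] by linarith
  have summ: "summable (\<lambda>n. (complex_of_real (s n) * cinner x (e n)) *\<^sub>C f n)" for x
    by (intro orthonormal_series[OF f] diag_coeff_summable[OF e s])
  have bound: "norm (g x) \<le> K * norm x" for x
  proof (rule power2_le_imp_le)
    show "(norm (g x))\<^sup>2 \<le> (K * norm x)\<^sup>2"
      unfolding g_def
      using orthonormal_series(2)[OF f diag_coeff_summable(1)[OF e s]]
        diag_coeff_summable(2)[OF e s, of x] order_trans by blast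
  qed (use K in simp)
  have add: "g (x + y) = g x + g y" for x y
    unfolding g_def suminf_add[OF summ summ]
    by (simp add: cinner_add_left ring_distribs scaleC_add_left)
  have scaleC: "g (c *\<^sub>C x) = c *\<^sub>C g x" for c x
    unfolding g_def bounded_linear.suminf[OF bounded_linear_scaleC_right summ]
    by (simp add: cinner_scaleC_left scaleC_scaleC mult_ac)
  have "bounded_linear g"
    by (rule bounded_linear_intro[where K = K])
      (use bound in \<open>simp_all add: add scaleC scaleR_scaleC mult.commute\<close>)
  then have app: "blinfun_apply (diag_op s e f) = g"
    unfolding diag_op_def by (subst bounded_linear_Blinfun_apply) (simp_all add: g_def[abs_def])
  show "(\<lambda>n. (complex_of_real (s n) * cinner x (e n)) *\<^sub>C f n) sums diag_op s e f x"
    unfolding app g_def by (rule summable_sums[OF summ])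
  show "cinner (diag_op s e f x) (f k) = complex_of_real (s k) * cinner x (e k)"
    unfolding app g_def by (rule orthonormal_series(3)[OF f diag_coeff_summable(1)[OF e s]])
  show "norm (diag_op s e f x) \<le> K * norm x"
    unfolding app by (rule bound)
  show "diag_op s e f \<in> BH"
    by (simp add: BH_def app scaleC)
qed

lemma diag_op_basis:
  fixes e f :: "nat \<Rightarrow> 'a::complex_hilbert_space"
  assumes "orthonormal_on UNIV e" "orthonormal_on UNIV f" "\<forall>n. \<bar>s n\<bar> \<le> K"
  shows "diag_op s e f (e k) = complex_of_real (s k) *\<^sub>C f k"
proof -
  have "(\<lambda>n. (complex_of_real (s n) * cinner (e k) (e n)) *\<^sub>C f n)
      = (\<lambda>n. if n = k then complex_of_real (s k) *\<^sub>C f k else 0)"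
    using orthonormal_onD[OF assms(1), of k] by (auto simp: fun_eq_iff)
  with diag_op_series(1)[OF assms, of "e k"] sums_single[of k "\<lambda>_. complex_of_real (s k) *\<^sub>C f k"]
  show ?thesis by (metis sums_unique2)
qed

lemma diag_op_compose:
  fixes e f g :: "nat \<Rightarrow> 'a::complex_hilbert_space"
  assumes "orthonormal_on UNIV e" "orthonormal_on UNIV f" "orthonormal_on UNIV g"
    and s: "\<forall>n. \<bar>s n\<bar> \<le> K" and t: "\<forall>n. \<bar>t n\<bar> \<le> M"
  shows "diag_op t f g o\<^sub>L diag_op s e f = diag_op (\<lambda>n. t n * s n) e g"
proof (rule blinfun_eqI)
  fix x
  have st: "\<forall>n. \<bar>t n * s n\<bar> \<le> M * K"
    using s t by (auto simp: abs_mult intro!: mult_mono intro: order_trans[OF abs_ge_zero])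
  have "diag_op t f g (diag_op s e f x) = diag_op (\<lambda>n. t n * s n) e g x"
    using diag_op_series(1)[OF assms(2,3) t, of "diag_op s e f x"]
      diag_op_series(1)[OF assms(1,3) st, of x]
    by (intro sums_unique2) (auto simp: diag_op_series(2)[OF assms(1,2) s] mult_ac)
  then show "(diag_op t f g o\<^sub>L diag_op s e f) x = diag_op (\<lambda>n. t n * s n) e g x" by simp
qed

lemma diag_op_adjoint:
  fixes e f :: "nat \<Rightarrow> 'a::complex_hilbert_space"
  assumes e: "orthonormal_on UNIV e" and f: "orthonormal_on UNIV f" and s: "\<forall>n. \<bar>s n\<bar> \<le> K"
  shows "cinner (diag_op s e f x) y = cinner x (diag_op s f e y)"
proof -
  have "(\<lambda>n. cinner ((complex_of_real (s n) * cinner x (e n)) *\<^sub>C f n) y) sums cinner (diag_op s e f x) y"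
    by (rule bounded_linear.sums[OF bounded_linear_cinner_left diag_op_series(1)[OF assms]])
  moreover have "(\<lambda>n. cnj (cinner ((complex_of_real (s n) * cinner y (f n)) *\<^sub>C e n) x)) sums cnj (cinner (diag_op s f e y) x)"
    using bounded_linear.sums[OF bounded_linear_cinner_left diag_op_series(1)[OF f e s, of y]]
    by (simp only: sums_cnj)
  moreover have "cnj (cinner ((complex_of_real (s n) * cinner y (f n)) *\<^sub>C e n) x) =
      cinner ((complex_of_real (s n) * cinner x (e n)) *\<^sub>C f n) y" for n
    by (simp add: cinner_scaleC_left cinner_commute[symmetric] mult_ac)
  ultimately have "cinner (diag_op s e f x) y = cnj (cinner (diag_op s f e y) x)"
    by (metis (no_types, lifting) sums_cong sums_unique2)
  then show ?thesis by (simp add: cinner_commute[symmetric])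
qed

text \<open>Two candidates differ, at each point, by a vector orthogonal to itself. As
  \<open>cadjoint\<close> is a definite description, exhibiting one operator with the adjoint
  identity evaluates it.\<close>

lemma cadjoint_eqI:
  fixes A B :: "'a::complex_hilbert_space \<Rightarrow>\<^sub>L 'a"
  assumes "B \<in> BH" "\<And>x y. cinner (A x) y = cinner x (B y)"
  shows "cadjoint A = B"
  unfolding cadjoint_def
proof (rule the_equality)
  fix C assume C: "C \<in> BH \<and> (\<forall>x y. cinner (A x) y = cinner x (C y))"
  show "C = B"
  proof (rule blinfun_eqI)
    fix y
    have "cinner (C y - B y) (C y - B y) = 0"
      using C assms(2)[of "C y - B y" y] by (simp add: cinner_diff_right)
    then show "C y = B y" by (simp add: cinner_self)
  qed
qed (use assms in blast)

lemma cadjoint_diag_op: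
  fixes e f :: "nat \<Rightarrow> 'a::complex_hilbert_space"
  assumes "orthonormal_on UNIV e" "orthonormal_on UNIV f" "\<forall>n. \<bar>s n\<bar> \<le> K"
  shows "cadjoint (diag_op s e f) = diag_op s f e"
  by (rule cadjoint_eqI[OF diag_op_series(4)[OF assms(2,1,3)] diag_op_adjoint[OF assms]])

section \<open>Singular values of diagonal operators\<close>

lemma c0_star_bound: "s \<in> c0_star \<Longrightarrow> \<forall>n. \<bar>s n\<bar> \<le> s 0"
  by (simp add: c0_star_def decseq_def)

text \<open>Guards the use of \<open>card\<close>, which is 0 on infinite sets.\<close>

lemma c0_star_finite_level:
  assumes "s \<in> c0_star" "t > 0"
  shows "finite {n. s n = t}"
proof -
  have "s \<longlonglongrightarrow> 0" using assms by (simp add: c0_star_def)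
  with \<open>t > 0\<close> have "eventually (\<lambda>n. s n < t) sequentially"
    by (simp add: order_tendstoD)
  then obtain N where N: "\<And>n. n \<ge> N \<Longrightarrow> s n < t" by (auto simp: eventually_sequentially)
  have "{n. s n = t} \<subseteq> {..<N}"
    using N by (force simp: not_less[symmetric])
  then show ?thesis using finite_subset by blast
qed

text \<open>At the first index \<open>n\<close> where the two sequences differ, the larger value \<open>t\<close> is attained at
  strictly more places by the sequence with \<open>t\<close> in position \<open>n\<close>: the other one can attain \<open>t\<close>
  only before \<open>n\<close>.\<close>

lemma c0_star_eqI:
  assumes s: "s \<in> c0_star" and s': "s' \<in> c0_star"
    and card: "\<And>t. t > 0 \<Longrightarrow> card {n. s n = t} = card {n. s' n = t}"
  shows "s = s'"
proof (rule ccontr)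
  have *: False if s: "s \<in> c0_star" and s': "s' \<in> c0_star" and eq: "\<And>m. m < n \<Longrightarrow> s m = s' m"
    and less: "s' n < s n" and card: "card {m. s m = s n} = card {m. s' m = s n}" for s s' n
  proof -
    have "s n > 0" using less s' by (auto simp: c0_star_def intro: le_less_trans)
    have "m < n" if "s' m = s n" for m
    proof (rule ccontr)
      assume "\<not> m < n"
      then have "s' m \<le> s' n" using s' by (simp add: c0_star_def decseqD)
      with less that show False by simp
    qed
    then have "{m. s' m = s n} \<subset> {m. s m = s n}"
      using eq less by fastforce
    from psubset_card_mono[OF c0_star_finite_level[OF s \<open>s n > 0\<close>] this] card
    show False by linarith
  qed
  assume "s \<noteq> s'"
  then have ex: "\<exists>n. s n \<noteq> s' n" by auto
  define n where "n = (LEAST n. s n \<noteq> s' n)"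
  have n: "s n \<noteq> s' n" unfolding n_def by (rule LeastI_ex[OF ex])
  have eq: "s m = s' m" if "m < n" for m
    using not_less_Least that unfolding n_def by blast
  have pos: "s n \<ge> 0" "s' n \<ge> 0" using s s' by (auto simp: c0_star_def)
  show False
  proof (cases "s' n < s n")
    case True
    with pos show False using *[OF s s' eq] card[of "s n"] by force
  next
    case False
    with n pos show False using *[OF s' s, of n] eq card[of "s' n"] by force
  qed
qed

text \<open>Comparing coefficients along \<open>e n\<close> gives ((s n)^2 - t^2) *
  \<open>cinner x (e n)\<close> = 0, so only the finitely many indices with \<open>s n = t\<close>
  contribute.\<close>

lemma diag_op_eigenspace:
  fixes e :: "nat \<Rightarrow> 'a::complex_hilbert_space"
  assumes e: "orthonormal_on UNIV e" and s: "s \<in> c0_star" and t: "t > 0"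
  shows "{x. diag_op (\<lambda>n. s n * s n) e e x = complex_of_real (t\<^sup>2) *\<^sub>C x}
    = complex_vector.span (e ` {n. s n = t})" (is "?E = ?S")
proof -
  have b: "\<forall>n. \<bar>s n * s n\<bar> \<le> s 0 * s 0"
    using s by (auto simp: c0_star_def decseq_def abs_mult intro!: mult_mono)
  have nn: "s n \<ge> 0" for n using s by (simp add: c0_star_def)
  define D where "D = diag_op (\<lambda>n. s n * s n) e e"
  have D_scale: "D (c *\<^sub>C x) = c *\<^sub>C D x" for c x
    using diag_op_series(4)[OF e e b] by (auto simp: BH_def D_def)
  show ?thesis
  proof (intro equalityI subsetI)
    fix x assume "x \<in> ?E"
    then have x: "D x = complex_of_real (t\<^sup>2) *\<^sub>C x" by (simp add: D_def)
    have coef: "cinner x (e n) = 0" if "s n \<noteq> t" for n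
    proof -
      have "complex_of_real (s n * s n) * cinner x (e n) = complex_of_real (t\<^sup>2) * cinner x (e n)"
        using diag_op_series(2)[OF e e b, of x n] x by (auto simp: D_def cinner_scaleC_left)
      moreover have "s n * s n \<noteq> t\<^sup>2"
        using that nn[of n] t by (simp add: power2_eq_square[symmetric] power2_eq_iff)
      ultimately show ?thesis by (metis mult_cancel_right of_real_eq_iff)
    qed
    have "(\<lambda>n. (complex_of_real (s n * s n) * cinner x (e n)) *\<^sub>C e n) sums D x"
      using diag_op_series(1)[OF e e b] by (simp add: D_def)
    moreover have "(\<lambda>n. (complex_of_real (s n * s n) * cinner x (e n)) *\<^sub>C e n) sums
        (\<Sum>n\<in>{n. s n = t}. (complex_of_real (s n * s n) * cinner x (e n)) *\<^sub>C e n)"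
      by (rule sums_finite[OF c0_star_finite_level[OF s t]]) (simp add: coef)
    ultimately have Dx: "D x = (\<Sum>n\<in>{n. s n = t}. (complex_of_real (s n * s n) * cinner x (e n)) *\<^sub>C e n)"
      by (rule sums_unique2)
    have "D x \<in> ?S"
      unfolding Dx
      by (intro complex_vector.span_sum complex_vector.span_scale complex_vector.span_base) auto
    \<comment> \<open>Since \<open>e\<close> may be incomplete, \<open>x\<close> has no expansion to
      start from; it is recovered from the expansion of \<open>D x\<close>, which is where
      \<open>t > 0\<close> enters.\<close>
    then have "complex_of_real (1 / t\<^sup>2) *\<^sub>C D x \<in> ?S"
      by (rule complex_vector.span_scale)
    then show "x \<in> ?S" using t by (simp add: x scaleC_scaleC scaleC_one)
  next
    fix x assume "x \<in> ?S"
    then have "D x = complex_of_real (t\<^sup>2) *\<^sub>C x"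
    proof (induction rule: complex_vector.span_induct_alt)
      case (step c x y)
      then have "D x = complex_of_real (t\<^sup>2) *\<^sub>C x"
        using diag_op_basis[OF e e b] by (auto simp: D_def power2_eq_square)
      with step show ?case
        by (simp add: D_scale blinfun.add_right scaleC_add_right scaleC_scaleC mult_ac)
    qed simp
    then show "x \<in> ?E" by (simp add: D_def)
  qed
qed

text \<open>The adjoint times the operator is diagonal along \<open>e\<close> with coefficients (s
  n)^2, so the eigenspace dimensions count the occurrences of each positive value of
  \<open>s\<close>; \<open>c0_star_eqI\<close> then resolves the definite description.\<close>

lemma s_numbers_diag_op:
  fixes e f :: "nat \<Rightarrow> 'a::complex_hilbert_space"
  assumes e: "orthonormal_on UNIV e" and f: "orthonormal_on UNIV f" and s: "s \<in> c0_star"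
  shows "s_numbers (diag_op s e f) = s"
proof -
  note b = c0_star_bound[OF s]
  have "cadjoint (diag_op s e f) o\<^sub>L diag_op s e f = diag_op (\<lambda>n. s n * s n) e e"
    unfolding cadjoint_diag_op[OF e f b] by (rule diag_op_compose[OF e f e b b])
  moreover have "card {n. s n = t} = complex_vector.dim (complex_vector.span (e ` {n. s n = t}))"
    if "t > 0" for t
  proof -
    have "orthonormal_on {n. s n = t} e" by (rule orthonormal_on_subset[OF e]) simp
    note * = orthonormal_independent[OF this c0_star_finite_level[OF s that]]
    show ?thesis
      by (simp add: complex_vector.dim_eq_card_independent[OF *(2)] card_image[OF *(1)])
  qed
  ultimately have dim: "complex_vector.dim {x. (cadjoint (diag_op s e f) o\<^sub>L diag_op s e f) x = complex_of_real (t\<^sup>2) *\<^sub>C x}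
      = card {n. s n = t}" if "t > 0" for t
    using that by (simp only: diag_op_eigenspace[OF e s that])
  show ?thesis
    unfolding s_numbers_def
  proof (rule the_equality)
    fix s' assume "s' \<in> c0_star \<and> (\<forall>t>0. card {n. s' n = t} = complex_vector.dim
      {x. (cadjoint (diag_op s e f) o\<^sub>L diag_op s e f) x = complex_of_real (t\<^sup>2) *\<^sub>C x})"
    then show "s' = s" using s dim by (intro c0_star_eqI) auto
  qed (use s dim in auto)
qed

section \<open>The singular value decomposition\<close>

lemma compact_op_convergent_subseq:
  fixes X :: "'a::complex_hilbert_space \<Rightarrow>\<^sub>L 'a"
  assumes "compact_op X" "\<And>n. norm (x n) \<le> 1"
  obtains r l where "strict_mono (r :: nat \<Rightarrow> nat)" "(\<lambda>n. X (x (r n))) \<longlonglongrightarrow> l"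
proof -
  have "\<forall>n. X (x n) \<in> closure (blinfun_apply X ` cball 0 1)"
    using assms(2) closure_subset by fastforce
  from assms(1)[unfolded compact_op_def compact_def, THEN conjunct2, THEN spec[of _ "\<lambda>n. X (x n)"],
      THEN mp, OF this]
  obtain l r where "strict_mono r" "((\<lambda>n. X (x n)) \<circ> r) \<longlonglongrightarrow> l" by blast
  then show thesis using that by (simp add: o_def)
qed

text \<open>If unit vectors nearly attain the norm and their images converge, then the parallelogram law
  makes the vectors themselves a Cauchy sequence.\<close>

lemma compact_op_maximizer:
  fixes X :: "'a::complex_hilbert_space \<Rightarrow>\<^sub>L 'a"
  assumes X: "compact_op X" and V: "subspace V" "closed V" and u: "u \<in> V" "norm u = 1"
  shows "\<exists>v\<in>V. norm v = 1 \<and> (\<forall>y\<in>V. norm (X y) \<le> norm (X v) * norm y)"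
proof -
  define S where "S = {norm (X y) |y. y \<in> V \<and> norm y = 1}"
  define \<sigma> where "\<sigma> = Sup S"
  have ne: "S \<noteq> {}" using u by (auto simp: S_def)
  have "bdd_above S"
  proof (rule bdd_aboveI[of _ "norm X"])
    fix a assume "a \<in> S"
    then obtain y where "a = norm (X y)" "norm y = 1" by (auto simp: S_def)
    with norm_blinfun[of X y] show "a \<le> norm X" by simp
  qed
  then have up: "norm (X y) \<le> \<sigma>" if "y \<in> V" "norm y = 1" for y
    unfolding \<sigma>_def using that by (intro cSup_upper) (auto simp: S_def)
  have bound: "norm (X y) \<le> \<sigma> * norm y" if "y \<in> V" for y
  proof (cases "y = 0")
    case False
    have "norm (X ((1 / norm y) *\<^sub>R y)) \<le> \<sigma>"
      using False by (intro up subspace_scale V that) simp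
    then show ?thesis using False by (simp add: blinfun.scaleR_right field_simps)
  qed (simp add: blinfun.zero_right)
  have "\<sigma> \<ge> 0" using up[OF u] norm_ge_zero order_trans by blast
  show ?thesis
  proof (cases "\<sigma> = 0")
    case True
    then show ?thesis
      using u bound by (intro bexI[of _ u]) (auto intro: order_trans)
  next
    case False
    with \<open>\<sigma> \<ge> 0\<close> have pos: "\<sigma> > 0" by simp
    have "\<exists>y\<in>V. norm y = 1 \<and> \<sigma> - 1 / (real n + 1) < norm (X y)" for n
    proof -
      have "\<sigma> - 1 / (real n + 1) < Sup S" by (simp add: \<sigma>_def)
      then show ?thesis using less_cSupD[OF ne] by (auto simp: S_def)
    qed
    then obtain y where y: "y n \<in> V" "norm (y n) = 1" "\<sigma> - 1 / (real n + 1) < norm (X (y n))" for n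
      by metis
    obtain r l where r: "strict_mono (r :: nat \<Rightarrow> nat)" "(\<lambda>n. X (y (r n))) \<longlonglongrightarrow> l"
      using compact_op_convergent_subseq[OF X, of y] y by auto
    define z where "z n = y (r n)" for n
    have z: "z n \<in> V" "norm (z n) = 1" for n using y by (auto simp: z_def)
    have Xz: "(\<lambda>n. X (z n)) \<longlonglongrightarrow> l" using r by (simp add: z_def)
    have "(\<lambda>n. norm (X (y n))) \<longlonglongrightarrow> \<sigma>"
    proof (rule tendsto_sandwich)
      show "\<forall>\<^sub>F n in sequentially. \<sigma> - 1 / (real n + 1) \<le> norm (X (y n))"
        using y(3) by (simp add: less_imp_le)
      show "\<forall>\<^sub>F n in sequentially. norm (X (y n)) \<le> \<sigma>"
        using up y by simp
      have "(\<lambda>n. \<sigma> - inverse (real (Suc n))) \<longlonglongrightarrow> \<sigma> - 0"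
        by (intro tendsto_diff tendsto_const LIMSEQ_inverse_real_of_nat)
      then show "(\<lambda>n. \<sigma> - 1 / (real n + 1)) \<longlonglongrightarrow> \<sigma>"
        by (simp add: inverse_eq_divide add.commute)
    qed simp
    then have "(\<lambda>n. norm (X (z n))) \<longlonglongrightarrow> \<sigma>"
      using LIMSEQ_subseq_LIMSEQ[OF _ r(1)] by (force simp: z_def o_def)
    then have norm_l: "norm l = \<sigma>"
      using tendsto_norm[OF Xz] LIMSEQ_unique by blast
    have "Cauchy z"
    proof (rule CauchyI)
      fix \<epsilon> :: real assume "\<epsilon> > 0"
      \<comment> \<open>If both images are within \<open>\<delta>\<close> of \<open>l\<close>, then
        \<sigma> |z_m + z_n| \<ge> 2\<sigma> - 2\<delta>, and the parallelogram law gives \<sigma>^2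
        |z_m - z_n|^2 \<le> 8\<sigma>\<delta> - 4\<delta>^2. The second bound on
        \<open>\<delta>\<close> pushes this below \<sigma>^2 \<epsilon>^2; the first keeps 2\<sigma>
        - 2\<delta> nonnegative for squaring.\<close>
      define \<delta> where "\<delta> = min \<sigma> (\<sigma> * \<epsilon>\<^sup>2 / 8)"
      have \<delta>: "\<delta> > 0" "\<delta> \<le> \<sigma>" "8 * \<sigma> * \<delta> \<le> \<sigma>\<^sup>2 * \<epsilon>\<^sup>2"
        using pos \<open>\<epsilon> > 0\<close> mult_left_mono[of \<delta> "\<sigma> * \<epsilon>\<^sup>2 / 8" "8 * \<sigma>"]
        by (auto simp: \<delta>_def power2_eq_square)
      obtain M where M: "\<And>n. n \<ge> M \<Longrightarrow> norm (X (z n) - l) < \<delta>"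
        using LIMSEQ_D[OF Xz \<delta>(1)] by blast
      show "\<exists>M. \<forall>m\<ge>M. \<forall>n\<ge>M. norm (z m - z n) < \<epsilon>"
      proof (intro exI allI impI)
        fix m n assume mn: "m \<ge> M" "n \<ge> M"
        have "2 * \<sigma> = norm ((X (z m) + X (z n)) - ((X (z m) - l) + (X (z n) - l)))"
          using norm_l by (simp add: scaleR_2[symmetric])
        also have "\<dots> \<le> norm (X (z m + z n)) + (norm (X (z m) - l) + norm (X (z n) - l))"
          unfolding blinfun.add_right
          by (intro order_trans[OF norm_triangle_ineq4] add_left_mono norm_triangle_ineq)
        finally have "2 * \<sigma> - 2 * \<delta> \<le> norm (X (z m + z n))"
          using M[OF mn(1)] M[OF mn(2)] by linarith
        also have "\<dots> \<le> \<sigma> * norm (z m + z n)"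
          by (intro bound subspace_add V z)
        finally have "(2 * \<sigma> - 2 * \<delta>)\<^sup>2 \<le> (\<sigma> * norm (z m + z n))\<^sup>2"
          using \<delta> by (intro power_mono) auto
        moreover have "(norm (z m + z n))\<^sup>2 = 4 - (norm (z m - z n))\<^sup>2"
          using z[of m] z[of n] by (simp add: power2_norm_eq_inner norm_eq_1 algebra_simps inner_commute)
        ultimately have "\<sigma>\<^sup>2 * (norm (z m - z n))\<^sup>2 \<le> 8 * \<sigma> * \<delta> - 4 * \<delta>\<^sup>2"
          by (simp add: power_mult_distrib algebra_simps power2_diff)
        also have "\<dots> < \<sigma>\<^sup>2 * \<epsilon>\<^sup>2"
          using \<delta> zero_less_power[OF \<delta>(1), of 2] by linarith
        finally have "(norm (z m - z n))\<^sup>2 < \<epsilon>\<^sup>2" using pos by simp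
        then show "norm (z m - z n) < \<epsilon>"
          using \<open>\<epsilon> > 0\<close> power_less_imp_less_base[of _ 2 \<epsilon>] by simp
      qed
    qed
    then obtain v where v: "z \<longlonglongrightarrow> v" using Cauchy_convergent convergent_def by blast
    have "v \<in> V" using closed_sequentially[OF V(2) z(1) v] .
    moreover have "norm v = 1"
      using tendsto_norm[OF v] z(2) LIMSEQ_unique[OF _ tendsto_const] by simp
    moreover have "X v = l"
      using blinfun.tendsto[OF tendsto_const v] Xz LIMSEQ_unique by blast
    ultimately show ?thesis using bound norm_l by auto
  qed
qed

text \<open>First-order optimality along \<open>v + c y\<close>, where the phase of \<open>c\<close> is chosen so that the cross
  term is nonnegative.\<close>

lemma maximizer_image_orthogonal:
  fixes X :: "'a::complex_hilbert_space \<Rightarrow>\<^sub>L 'a"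
  assumes X: "X \<in> BH" and max: "\<And>c. norm (X (v + c *\<^sub>C y)) \<le> norm (X v) * norm (v + c *\<^sub>C y)"
    and v: "norm v = 1" and orth: "cinner y v = 0"
  shows "cinner (X y) (X v) = 0"
proof (rule ccontr)
  define a where "a = cinner (X y) (X v)"
  assume "cinner (X y) (X v) \<noteq> 0"
  then have a: "(cmod a)\<^sup>2 > 0" by (simp add: a_def)
  define B where "B = (norm (X v))\<^sup>2 * (norm y)\<^sup>2"
  \<comment> \<open>With step size \<open>\<tau>\<close> maximality yields 2\<tau> |a|^2 \<le>
    \<tau>^2 B |a|^2, which is impossible once \<open>\<tau> * B < 1\<close>; the added 1 covers
    \<open>B = 0\<close>.\<close>
  define \<tau> where "\<tau> = 1 / (B + 1)"
  have B: "B \<ge> 0" by (simp add: B_def)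
  then have \<tau>: "\<tau> > 0" "\<tau> * B < 1" by (simp_all add: \<tau>_def)
  define c where "c = complex_of_real \<tau> * cnj a"
  have sq: "(norm (p + q))\<^sup>2 = (norm p)\<^sup>2 + 2 * Re (cinner q p) + (norm q)\<^sup>2" for p q :: 'a
    by (simp add: Re_cinner power2_norm_eq_inner algebra_simps inner_commute)
  have ca: "Re (c * a) = \<tau> * (cmod a)\<^sup>2"
    unfolding cmod_power2 c_def by (simp add: power2_eq_square algebra_simps)
  have "(norm (v + c *\<^sub>C y))\<^sup>2 = 1 + \<tau>\<^sup>2 * (cmod a)\<^sup>2 * (norm y)\<^sup>2"
    using \<tau> by (simp add: sq v cinner_scaleC_left orth norm_scaleC c_def norm_mult power_mult_distrib)
  moreover have "(norm (X (v + c *\<^sub>C y)))\<^sup>2 = (norm (X v))\<^sup>2 + 2 * (\<tau> * (cmod a)\<^sup>2) + (norm (c *\<^sub>C X y))\<^sup>2"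
    using X unfolding ca[symmetric] by (simp add: BH_def blinfun.add_right sq cinner_scaleC_left a_def)
  moreover have "(norm (X (v + c *\<^sub>C y)))\<^sup>2 \<le> (norm (X v))\<^sup>2 * (norm (v + c *\<^sub>C y))\<^sup>2"
    using power_mono[OF max[of c], of 2] by (simp add: power_mult_distrib)
  ultimately have "2 * (\<tau> * (cmod a)\<^sup>2) + (norm (c *\<^sub>C X y))\<^sup>2
      \<le> (norm (X v))\<^sup>2 * (\<tau>\<^sup>2 * (cmod a)\<^sup>2 * (norm y)\<^sup>2)"
    by (simp add: distrib_left)
  then have "2 * (\<tau> * (cmod a)\<^sup>2) \<le> (norm (X v))\<^sup>2 * (\<tau>\<^sup>2 * (cmod a)\<^sup>2 * (norm y)\<^sup>2)"
    using zero_le_power2[of "norm (c *\<^sub>C X y)"] by linarith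
  also have "\<dots> = (\<tau> * B) * (\<tau> * (cmod a)\<^sup>2)"
    by (simp add: B_def power2_eq_square mult_ac)
  also have "\<dots> < 1 * (\<tau> * (cmod a)\<^sup>2)"
    using \<tau> a by (intro mult_strict_right_mono) auto
  finally show False using \<tau> a by simp
qed

text \<open>Greedy construction: \<open>e n\<close> maximises |X y| over unit vectors orthogonal to
  its predecessors. Maximality gives everything: the values decrease, the images are pairwise
  orthogonal, and X is bounded by \<open>s n\<close> on the remaining complement.\<close>

lemma compact_op_svd:
  fixes X :: "'a::complex_hilbert_space \<Rightarrow>\<^sub>L 'a"
  assumes inf: "\<not> (\<exists>B :: 'a set. finite B \<and> complex_vector.span B = UNIV)"
    and X: "compact_op X"
  obtains s e f where "s \<in> c0_star" "orthonormal_on UNIV e" "orthonormal_on UNIV f"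
    "X = diag_op s e f"
proof -
  have BH: "X \<in> BH" using X by (simp add: compact_op_def)
  then have X_scale: "X (c *\<^sub>C x) = c *\<^sub>C X x" for c x by (simp add: BH_def)
  define V where "V n e = {y. \<forall>m<n. cinner y (e m) = 0}" for n :: nat and e :: "nat \<Rightarrow> 'a"
  have V: "subspace (V n e)" "closed (V n e)" for n e
  proof -
    show "subspace (V n e)"
      by (auto simp: V_def subspace_def cinner_add_left cinner_scaleR_left)
    have "V n e = (\<Inter>m\<in>{..<n}. {y. cinner y (e m) = 0})" by (auto simp: V_def)
    also have "closed \<dots>"
      by (intro closed_INT ballI closed_Collect_eq linear_continuous_on bounded_linear_cinner_left
          continuous_on_const)
    finally show "closed (V n e)" .
  qed
  obtain e where e: "orthonormal_on UNIV e"
    and max: "\<And>n y. y \<in> V n e \<Longrightarrow> norm (X y) \<le> norm (X (e n)) * norm y"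
  proof (rule orthonormal_seq_choice[of "\<lambda>n f v. \<forall>y\<in>V n f. norm (X y) \<le> norm (X v) * norm y"])
    fix f :: "nat \<Rightarrow> 'a" and n assume "orthonormal_on {..<n} f"
    from orthonormal_extend[OF inf this] obtain u where "u \<in> V n f" "norm u = 1"
      by (auto simp: V_def)
    from compact_op_maximizer[OF X V this]
    show "\<exists>v. norm v = 1 \<and> (\<forall>m<n. cinner v (f m) = 0) \<and> (\<forall>y\<in>V n f. norm (X y) \<le> norm (X v) * norm y)"
      by (auto simp: V_def)
  qed (use that in \<open>auto simp: V_def\<close>)
  define s where "s n = norm (X (e n))" for n
  have norm_e: "norm (e n) = 1" for n using orthonormal_norm[OF e] by simp
  have dec: "decseq s"
  proof (rule decseq_SucI)
    fix n
    have "e (Suc n) \<in> V n e" using orthonormal_onD[OF e] by (auto simp: V_def)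
    from max[OF this] show "s (Suc n) \<le> s n" by (simp add: s_def norm_e)
  qed
  have orth_lt: "cinner (X (e n)) (X (e m)) = 0" if "m < n" for m n
  proof (rule maximizer_image_orthogonal[OF BH _ norm_e])
    fix c have "e m + c *\<^sub>C e n \<in> V m e"
      using that orthonormal_onD[OF e] by (auto simp: V_def cinner_add_left cinner_scaleC_left)
    then show "norm (X (e m + c *\<^sub>C e n)) \<le> norm (X (e m)) * norm (e m + c *\<^sub>C e n)" by (rule max)
    show "cinner (e n) (e m) = 0" using that orthonormal_onD[OF e] by auto
  qed
  have dist: "(dist (X (e m)) (X (e n)))\<^sup>2 = (s m)\<^sup>2 + (s n)\<^sup>2" if "m < n" for m n
  proof -
    have "X (e n) \<bullet> X (e m) = 0" using orth_lt[OF that] by (simp flip: Re_cinner)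
    then show ?thesis
      by (simp add: dist_norm s_def power2_norm_eq_inner algebra_simps inner_commute)
  qed
  \<comment> \<open>Otherwise the images of the \<open>e n\<close> would be pairwise at least
    \<open>\<epsilon>\<close> apart, against compactness.\<close>
  have lim: "s \<longlonglongrightarrow> 0"
  proof (rule ccontr)
    assume "\<not> s \<longlonglongrightarrow> 0"
    then obtain \<epsilon> where \<epsilon>: "\<epsilon> > 0" "\<And>N. \<exists>n\<ge>N. s n \<ge> \<epsilon>"
      by (auto simp: LIMSEQ_iff not_less s_def)
    have ge: "s n \<ge> \<epsilon>" for n using \<epsilon>(2)[of n] decseqD[OF dec] order_trans by blast
    obtain r l where r: "strict_mono (r :: nat \<Rightarrow> nat)" "(\<lambda>n. X (e (r n))) \<longlonglongrightarrow> l"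
      using compact_op_convergent_subseq[OF X, of e] norm_e by auto
    from LIMSEQ_imp_Cauchy[OF r(2)] \<epsilon>(1) obtain N
      where N: "\<And>m n. m \<ge> N \<Longrightarrow> n \<ge> N \<Longrightarrow> dist (X (e (r m))) (X (e (r n))) < \<epsilon>"
      unfolding Cauchy_def by blast
    have "r N < r (Suc N)" using r(1) by (simp add: strict_mono_Suc_iff)
    note dist[OF this]
    moreover have "(dist (X (e (r N))) (X (e (r (Suc N)))))\<^sup>2 < \<epsilon>\<^sup>2"
      using N[of N "Suc N"] by (intro power_strict_mono) auto
    moreover have "(s (r N))\<^sup>2 \<ge> \<epsilon>\<^sup>2" using ge \<epsilon> by (intro power_mono) auto
    ultimately show False using zero_le_power2[of "s (r (Suc N))"] by linarith
  qed
  \<comment> \<open>Normalised images as long as the singular value is positive, arbitrary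
    orthonormal continuation afterwards. Because \<open>s\<close> decreases, a positive
    \<open>s n\<close> means that all earlier vectors were prescribed too.\<close>
  obtain f where f: "orthonormal_on UNIV f"
    and f_eq: "\<And>n. s n > 0 \<Longrightarrow> f n = complex_of_real (1 / s n) *\<^sub>C X (e n)"
  proof (rule orthonormal_seq_choice[of "\<lambda>n _ v. s n > 0 \<longrightarrow> v = complex_of_real (1 / s n) *\<^sub>C X (e n)"])
    fix f :: "nat \<Rightarrow> 'a" and n
    assume f: "orthonormal_on {..<n} f"
      and hist: "\<And>m. m < n \<Longrightarrow> s m > 0 \<longrightarrow> f m = complex_of_real (1 / s m) *\<^sub>C X (e m)"
    show "\<exists>v. norm v = 1 \<and> (\<forall>m<n. cinner v (f m) = 0) \<and>
      (s n > 0 \<longrightarrow> v = complex_of_real (1 / s n) *\<^sub>C X (e n))"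
    proof (cases "s n > 0")
      case True
      have "cinner (complex_of_real (1 / s n) *\<^sub>C X (e n)) (f m) = 0" if "m < n" for m
      proof -
        have "s m > 0" using True decseqD[OF dec, of m n] that by simp
        then show ?thesis
          using hist[OF that] orth_lt[OF that] by (simp add: cinner_scaleC_left cinner_scaleC_right)
      qed
      moreover have "norm (complex_of_real (1 / s n) *\<^sub>C X (e n)) = 1"
        using True by (simp add: norm_scaleC norm_divide s_def)
      ultimately show ?thesis by blast
    next
      case False
      with orthonormal_extend[OF inf f] show ?thesis by auto
    qed
  qed (use that in auto)
  have Xe: "X (e n) = complex_of_real (s n) *\<^sub>C f n" for n
  proof (cases "s n = 0")
    case True
    then show ?thesis by (simp add: s_def)
  next
    case False
    then have "s n > 0" by (simp add: s_def)
    then show ?thesis by (simp add: f_eq scaleC_scaleC scaleC_one)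
  qed
  have c0: "s \<in> c0_star" using dec lim by (simp add: c0_star_def s_def)
  have "X = diag_op s e f"
  proof (rule blinfun_eqI)
    fix x
    define P where "P N = (\<Sum>n<N. cinner x (e n) *\<^sub>C e n)" for N
    have eN: "orthonormal_on {..<N} e" for N by (rule orthonormal_on_subset[OF e]) simp
    \<comment> \<open>The residual \<open>x - P N\<close> lies in the complement on which X has norm
      at most \<open>s N\<close>. This works even for an incomplete \<open>e\<close>: whatever lies
      outside its closed span is sent to 0 in the limit.\<close>
    have "norm (X x - X (P N)) \<le> s N * norm x" for N
    proof -
      have "x - P N \<in> V N e"
        using orthonormal_residual[OF eN] by (auto simp: V_def P_def)
      then have "norm (X (x - P N)) \<le> s N * norm (x - P N)"
        unfolding s_def by (rule max)
      also have "\<dots> \<le> s N * norm x"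
      proof (rule mult_left_mono)
        have "0 \<le> (\<Sum>n<N. (cmod (cinner x (e n)))\<^sup>2)" by (intro sum_nonneg) auto
        then have "(norm (x - P N))\<^sup>2 \<le> (norm x)\<^sup>2"
          unfolding P_def using orthonormal_residual_norm[OF eN[of N] finite_lessThan, of x] by linarith
        then show "norm (x - P N) \<le> norm x" by (rule power2_le_imp_le) simp
      qed (simp add: s_def)
      finally show ?thesis by (simp add: blinfun.diff_right)
    qed
    then have "(\<lambda>N. X x - X (P N)) \<longlonglongrightarrow> 0"
      using tendsto_mult_left_zero[OF lim, of "norm x"]
      by (intro Lim_null_comparison[of "\<lambda>N. X x - X (P N)" "\<lambda>N. s N * norm x"]) auto
    from tendsto_diff[OF tendsto_const[of "X x"] this] have "(\<lambda>N. X (P N)) \<longlonglongrightarrow> X x" by simp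
    moreover have "X (P N) = (\<Sum>n<N. (complex_of_real (s n) * cinner x (e n)) *\<^sub>C f n)" for N
      by (simp add: P_def blinfun.sum_right X_scale Xe scaleC_scaleC mult.commute)
    ultimately have "(\<lambda>n. (complex_of_real (s n) * cinner x (e n)) *\<^sub>C f n) sums X x"
      by (simp add: sums_def)
    then show "X x = diag_op s e f x"
      using diag_op_series(1)[OF e f c0_star_bound[OF c0]] sums_unique2 by blast
  qed
  with c0 e f show thesis by (rule that)
qed

section \<open>Ideals and diagonal operators\<close>

lemma two_sided_ideal_BH: "two_sided_ideal (BH :: ('a::complex_hilbert_space \<Rightarrow>\<^sub>L 'a) set)"
  by (auto simp: two_sided_ideal_def BH_def blinfun.add_left scaleC_add_right)

lemma two_sided_ideal_add: "two_sided_ideal I \<Longrightarrow> X \<in> I \<Longrightarrow> Y \<in> I \<Longrightarrow> X + Y \<in> I"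
  by (simp add: two_sided_ideal_def)

lemma two_sided_ideal_compose:
  assumes "two_sided_ideal I" "X \<in> I" "A \<in> BH"
  shows "A o\<^sub>L X \<in> I" "X o\<^sub>L A \<in> I"
  using assms by (simp_all add: two_sided_ideal_def)

lemma two_sided_ideal_hull:
  assumes "S \<subseteq> (BH :: ('a::complex_hilbert_space \<Rightarrow>\<^sub>L 'a) set)"
  shows "two_sided_ideal (two_sided_ideal hull S)"
proof -
  \<comment> \<open>\<open>BH\<close> itself is an ideal above \<open>S\<close>; were there none,
    the hull would be an empty intersection, hence the whole type.\<close>
  have "two_sided_ideal hull S \<subseteq> BH"
    by (rule hull_minimal) (use assms two_sided_ideal_BH in auto)
  moreover have mem: "Y \<in> two_sided_ideal hull S \<longleftrightarrow> (\<forall>T. two_sided_ideal T \<and> S \<subseteq> T \<longrightarrow> Y \<in> T)" for Y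
    by (auto simp: hull_def)
  moreover have "0 \<in> two_sided_ideal hull S"
    unfolding mem by (simp add: two_sided_ideal_def)
  moreover have "X + Y \<in> two_sided_ideal hull S"
    if "X \<in> two_sided_ideal hull S" "Y \<in> two_sided_ideal hull S" for X Y
    using that two_sided_ideal_add unfolding mem by meson
  moreover have "A o\<^sub>L X \<in> two_sided_ideal hull S" "X o\<^sub>L A \<in> two_sided_ideal hull S"
    if "X \<in> two_sided_ideal hull S" "A \<in> BH" for X A
    using that two_sided_ideal_compose unfolding mem by meson+
  ultimately show ?thesis
    unfolding two_sided_ideal_def[of "two_sided_ideal hull S"] by (intro conjI ballI)
qed

lemma op_ideal_hull:
  fixes S :: "('a::complex_hilbert_space \<Rightarrow>\<^sub>L 'a) set"
  assumes "op_ideal I" "S \<subseteq> I" "X \<in> S" "X \<noteq> 0"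
  shows "op_ideal (two_sided_ideal hull S)" "two_sided_ideal hull S \<subseteq> I"
proof -
  have "S \<subseteq> BH" using assms by (auto simp: op_ideal_def two_sided_ideal_def)
  note ideal = two_sided_ideal_hull[OF this]
  show sub: "two_sided_ideal hull S \<subseteq> I"
    by (rule hull_minimal) (use assms in \<open>auto simp: op_ideal_def\<close>)
  have "X \<in> two_sided_ideal hull S" using assms(3) by (rule hull_inc)
  then show "op_ideal (two_sided_ideal hull S)"
    using sub ideal assms by (auto simp: op_ideal_def)
qed

lemma op_ideal_nonzero:
  assumes "op_ideal I"
  obtains X where "X \<in> I" "X \<noteq> 0"
  using assms by (auto simp: op_ideal_def two_sided_ideal_def)

lemma cscale_op_apply [simp]: "blinfun_apply (cscale_op c A) x = c *\<^sub>C A x"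
  by transfer simp

text \<open>Closure under complex scalars is not part of \<open>two_sided_ideal\<close>; it comes
  from multiplying by scalar multiples of the identity.\<close>

lemma ideal_cscale_op:
  fixes I :: "('a::complex_hilbert_space \<Rightarrow>\<^sub>L 'a) set"
  assumes "two_sided_ideal I" "X \<in> I"
  shows "cscale_op c X \<in> I"
proof -
  have "cscale_op c id_blinfun \<in> (BH :: ('a \<Rightarrow>\<^sub>L 'a) set)"
    by (simp add: BH_def scaleC_scaleC mult.commute)
  then have "cscale_op c id_blinfun o\<^sub>L X \<in> I"
    using assms by (simp add: two_sided_ideal_def)
  also have "cscale_op c id_blinfun o\<^sub>L X = cscale_op c X"
    by (rule blinfun_eqI) simp
  finally show ?thesis .
qed

lemma cscale_op_minus_one: "cscale_op (- 1) X = - X"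
  by (rule blinfun_eqI) (simp add: blinfun.minus_left complex_vector.scale_minus_left scaleC_one)

lemma ideal_diff:
  assumes "two_sided_ideal I" "X \<in> I" "Y \<in> I"
  shows "X - Y \<in> I"
  using assms ideal_cscale_op[OF assms(1,3), of "- 1"]
  by (metis cscale_op_minus_one diff_conv_add_uminus two_sided_ideal_def)

lemma ideal_sum:
  assumes "two_sided_ideal I" "\<And>k. k \<in> A \<Longrightarrow> F k \<in> I"
  shows "(\<Sum>k\<in>A. F k) \<in> I"
  using assms(2)
  by (induction A rule: infinite_finite_induct) (use assms(1) in \<open>auto simp: two_sided_ideal_def\<close>)

text \<open>Factorisation: go from \<open>g\<close> to \<open>e\<close> with coefficients 1, apply
  the given operator, and go from \<open>f\<close> to \<open>h\<close> with the bounded quotients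
  t/s.\<close>

lemma ideal_diag_op_dominated:
  fixes e f g h :: "nat \<Rightarrow> 'a::complex_hilbert_space"
  assumes I: "two_sided_ideal I" and mem: "diag_op s e f \<in> I"
    and e: "orthonormal_on UNIV e" and f: "orthonormal_on UNIV f"
    and g: "orthonormal_on UNIV g" and h: "orthonormal_on UNIV h"
    and s: "\<forall>n. \<bar>s n\<bar> \<le> K" and t: "\<And>n. \<bar>t n\<bar> \<le> C * \<bar>s n\<bar>"
  shows "diag_op t g h \<in> I"
proof -
  \<comment> \<open>Where \<open>s n = 0\<close> the quotient is 0 by convention, which is right
    because \<open>t n\<close> vanishes there as well.\<close>
  define r where "r n = t n / s n" for n
  have r: "\<forall>n. \<bar>r n\<bar> \<le> \<bar>C\<bar>"
  proof
    fix n
    have "\<bar>t n\<bar> \<le> \<bar>C\<bar> * \<bar>s n\<bar>" using t[of n] by (meson abs_ge_self abs_ge_zero mult_right_mono order_trans)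
    then show "\<bar>r n\<bar> \<le> \<bar>C\<bar>" by (cases "s n = 0") (simp_all add: r_def divide_le_eq)
  qed
  have rs: "r n * s n = t n" for n using t[of n] by (cases "s n = 0") (simp_all add: r_def)
  have tb: "\<forall>n. \<bar>t n\<bar> \<le> \<bar>C\<bar> * K"
    using r s by (auto simp: abs_mult simp flip: rs intro!: mult_mono intro: order_trans[OF abs_ge_zero])
  have one: "\<forall>n::nat. \<bar>1::real\<bar> \<le> 1" by simp
  have "diag_op (\<lambda>_. 1) g e \<in> BH" "diag_op r f h \<in> BH"
    by (rule diag_op_series(4)[OF g e one]) (rule diag_op_series(4)[OF f h r])
  then have "(diag_op r f h o\<^sub>L diag_op s e f) o\<^sub>L diag_op (\<lambda>_. 1) g e \<in> I"
    using I mem by (simp add: two_sided_ideal_def)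
  also have "diag_op r f h o\<^sub>L diag_op s e f = diag_op t e h"
    using diag_op_compose[OF e f h s r] by (simp add: rs)
  also have "diag_op t e h o\<^sub>L diag_op (\<lambda>_. 1) g e = diag_op t g h"
    using diag_op_compose[OF g e h one tb] by simp
  finally show ?thesis .
qed

lemma compact_op_s_numbers:
  fixes X :: "'a::complex_hilbert_space \<Rightarrow>\<^sub>L 'a"
  assumes "\<not> (\<exists>B :: 'a set. finite B \<and> complex_vector.span B = UNIV)" and "compact_op X"
  obtains e f where "s_numbers X \<in> c0_star" "orthonormal_on UNIV e" "orthonormal_on UNIV f"
    "X = diag_op (s_numbers X) e f"
proof -
  obtain s e f where *: "s \<in> c0_star" "orthonormal_on UNIV e" "orthonormal_on UNIV f" "X = diag_op s e f"
    by (rule compact_op_svd[OF assms])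
  then have "s_numbers X = s" using s_numbers_diag_op by blast
  then show thesis using that[of e f] * by simp
qed

lemma mem_ideal_if_s_numbers_le:
  fixes X Y :: "'a::complex_hilbert_space \<Rightarrow>\<^sub>L 'a"
  assumes inf: "\<not> (\<exists>B :: 'a set. finite B \<and> complex_vector.span B = UNIV)"
    and I: "two_sided_ideal I" and X: "compact_op X" and Y: "compact_op Y" "Y \<in> I"
    and le: "\<And>n. s_numbers X n \<le> C * s_numbers Y n"
  shows "X \<in> I"
proof -
  obtain e f where Xd: "s_numbers X \<in> c0_star" "orthonormal_on UNIV e" "orthonormal_on UNIV f"
    "X = diag_op (s_numbers X) e f"
    by (rule compact_op_s_numbers[OF inf X])
  obtain g h where Yd: "s_numbers Y \<in> c0_star" "orthonormal_on UNIV g" "orthonormal_on UNIV h"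
    "Y = diag_op (s_numbers Y) g h"
    by (rule compact_op_s_numbers[OF inf Y(1)])
  have "diag_op (s_numbers Y) g h \<in> I" using Y(2) Yd(4) by simp
  then have "diag_op (s_numbers X) e f \<in> I"
    using Xd(1) Yd(1) le
    by (intro ideal_diag_op_dominated[OF I _ Yd(2,3) Xd(2,3) c0_star_bound[OF Yd(1)], where C = C])
      (auto simp: c0_star_def)
  then show ?thesis using Xd(4) by simp
qed

section \<open>Banach ideals\<close>

definition rank_one :: "'a::complex_hilbert_space \<Rightarrow> 'a \<Rightarrow> ('a \<Rightarrow>\<^sub>L 'a)"
  where "rank_one u v = Blinfun (\<lambda>x. cinner x v *\<^sub>C u)"

lemma bounded_linear_scaleC_left: "bounded_linear (\<lambda>c. c *\<^sub>C (x::'a::complex_hilbert_space))"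
  by (rule bounded_linear_intro[where K = "norm x"])
    (simp_all add: scaleC_add_left scaleR_scaleC scaleC_scaleC norm_scaleC scaleR_conv_of_real)

lemma rank_one_apply: "rank_one u v x = cinner x v *\<^sub>C (u::'a::complex_hilbert_space)"
  unfolding rank_one_def
  by (simp add: bounded_linear_Blinfun_apply
      bounded_linear_compose[OF bounded_linear_scaleC_left bounded_linear_cinner_left])

lemma rank_one_BH: "rank_one u v \<in> BH"
  by (simp add: BH_def rank_one_apply cinner_scaleC_left scaleC_scaleC)

lemma norm_rank_one_le: "norm (rank_one u v) \<le> norm u * norm v"
proof (rule norm_blinfun_bound)
  fix x
  have "cmod (cinner x v) * norm u \<le> (norm x * norm v) * norm u"
    by (intro mult_right_mono cmod_cinner_le) simp
  then show "norm (rank_one u v x) \<le> norm u * norm v * norm x"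
    by (simp add: rank_one_apply norm_scaleC mult_ac)
qed simp

lemma rank_one_sandwich:
  "rank_one z u o\<^sub>L Y o\<^sub>L rank_one v z = cscale_op (cinner (Y v) u) (rank_one z z)" if "Y \<in> BH"
proof (rule blinfun_eqI)
  fix x
  have "Y (c *\<^sub>C v) = c *\<^sub>C Y v" for c using that by (simp add: BH_def)
  then show "(rank_one z u o\<^sub>L Y o\<^sub>L rank_one v z) x = cscale_op (cinner (Y v) u) (rank_one z z) x"
    by (simp add: rank_one_apply cinner_scaleC_left scaleC_scaleC mult.commute)
qed

text \<open>Compressing \<open>Y\<close> to a fixed rank one operator with coefficient \<open>\<langle>Y v, Y v\<rangle>\<close> recovers the size
  of \<open>Y v\<close> from any symmetric norm.\<close>

lemma symmetric_norm_dominates: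
  fixes I :: "('a::complex_hilbert_space \<Rightarrow>\<^sub>L 'a) set"
  assumes I: "op_ideal I" and N: "symmetric_norm_on I N"
  obtains K where "\<forall>Y\<in>I. norm Y \<le> K * N Y"
proof -
  have ideal: "two_sided_ideal I" using I by (simp add: op_ideal_def)
  then have BH: "Y \<in> BH" if "Y \<in> I" for Y using that by (auto simp: two_sided_ideal_def)
  have sandwich: "A o\<^sub>L Y o\<^sub>L B \<in> I" if "A \<in> BH" "Y \<in> I" "B \<in> BH" for A B Y
    using ideal that by (simp add: two_sided_ideal_def)
  have N_sandwich: "N (A o\<^sub>L Y o\<^sub>L B) \<le> norm A * N Y * norm B" if "Y \<in> I" "A \<in> BH" "B \<in> BH" for A B Y
    using N that unfolding symmetric_norm_on_def by blast
  from I obtain Z where Z: "Z \<in> I" "Z \<noteq> 0" by (rule op_ideal_nonzero)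
  then obtain z where z: "Z z \<noteq> 0" by (metis blinfun_eqI zero_blinfun.rep_eq)
  then have "z \<noteq> 0" by (auto simp: blinfun.zero_right)
  define E where "E = rank_one z z"
  \<comment> \<open>Compressing a nonzero member \<open>Z\<close> of the ideal gives
    \<open>c\<close> times \<open>E\<close>; dividing by \<open>c\<close> places \<open>E\<close> in
    the ideal, so that \<open>N E\<close> is a usable unit of measurement.\<close>
  define c where "c = cinner (Z z) (Z z)"
  have c: "c \<noteq> 0" using z by (simp add: c_def cinner_self)
  have "cscale_op c E \<in> I"
    using sandwich[OF rank_one_BH Z(1) rank_one_BH]
    unfolding E_def c_def rank_one_sandwich[OF BH[OF Z(1)], symmetric] by blast
  then have "cscale_op (inverse c) (cscale_op c E) \<in> I" by (rule ideal_cscale_op[OF ideal])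
  also have "cscale_op (inverse c) (cscale_op c E) = E"
    by (rule blinfun_eqI) (simp add: scaleC_scaleC c scaleC_one)
  finally have E: "E \<in> I" .
  have "E z \<noteq> 0" using \<open>z \<noteq> 0\<close> by (simp add: E_def rank_one_apply cinner_self)
  then have "E \<noteq> 0" by auto
  with N E have NE: "N E > 0" unfolding symmetric_norm_on_def by (metis order_less_le)
  show thesis
  proof (rule that, rule ballI)
    fix Y assume Y: "Y \<in> I"
    have NY: "N Y \<ge> 0" using N Y by (simp add: symmetric_norm_on_def)
    have "norm (Y v) \<le> (norm z)\<^sup>2 / N E * N Y * norm v" for v
    proof (cases "Y v = 0")
      case False
      \<comment> \<open>With this choice the compression coefficient is |Y v|^2, and one factor |Y
        v| cancels against the norm of \<open>rank_one z u\<close>.\<close>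
      define u where "u = Y v"
      have "cmod (cinner u u) * N E = N (cscale_op (cinner (Y v) u) E)"
        using N E by (simp add: symmetric_norm_on_def u_def)
      also have "\<dots> = N (rank_one z u o\<^sub>L Y o\<^sub>L rank_one v z)"
        by (simp only: rank_one_sandwich[OF BH[OF Y]] E_def)
      also have "\<dots> \<le> norm (rank_one z u) * N Y * norm (rank_one v z)"
        by (rule N_sandwich[OF Y rank_one_BH rank_one_BH])
      also have "\<dots> \<le> (norm z * norm u) * N Y * (norm v * norm z)"
        using NY by (intro mult_mono norm_rank_one_le mult_nonneg_nonneg) auto
      finally have "norm u * (norm u * N E) \<le> norm u * ((norm z)\<^sup>2 * N Y * norm v)"
        by (simp add: cinner_self power2_eq_square mult_ac norm_mult)
      then have "norm u * N E \<le> (norm z)\<^sup>2 * N Y * norm v"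
        using False by (simp add: u_def)
      then show ?thesis using NE by (simp add: u_def field_simps)
    qed (use NE NY in simp)
    then show "norm Y \<le> (norm z)\<^sup>2 / N E * N Y"
      using NE NY by (intro norm_blinfun_bound) auto
  qed
qed

section \<open>Linear combinations and limits of diagonal operators\<close>

lemma diag_op_eqI:
  fixes e f :: "nat \<Rightarrow> 'a::complex_hilbert_space" and A :: "'a \<Rightarrow>\<^sub>L 'a"
  assumes "orthonormal_on UNIV e" "orthonormal_on UNIV f" "\<forall>n. \<bar>s n\<bar> \<le> K"
    and "\<And>x. (\<lambda>n. (complex_of_real (s n) * cinner x (e n)) *\<^sub>C f n) sums A x"
  shows "diag_op s e f = A"
  by (rule blinfun_eqI) (use sums_unique2[OF diag_op_series(1)[OF assms(1-3)] assms(4)] in blast)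

lemma diag_op_diff:
  fixes e f :: "nat \<Rightarrow> 'a::complex_hilbert_space"
  assumes e: "orthonormal_on UNIV e" and f: "orthonormal_on UNIV f"
    and s: "\<forall>n. \<bar>s n\<bar> \<le> K" and t: "\<forall>n. \<bar>t n\<bar> \<le> M"
  shows "diag_op (\<lambda>n. s n - t n) e f = diag_op s e f - diag_op t e f"
proof (rule diag_op_eqI[OF e f])
  show "\<forall>n. \<bar>s n - t n\<bar> \<le> K + M" using s t by (meson abs_triangle_ineq4 add_mono order_trans)
  show "(\<lambda>n. (complex_of_real (s n - t n) * cinner x (e n)) *\<^sub>C f n) sums (diag_op s e f - diag_op t e f) x" for x
    using sums_diff[OF diag_op_series(1)[OF e f s, of x] diag_op_series(1)[OF e f t, of x]]
    by (simp add: blinfun.diff_left left_diff_distrib complex_vector.scale_left_diff_distrib)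
qed

lemma diag_op_sum_scaled:
  fixes e f :: "nat \<Rightarrow> 'a::complex_hilbert_space"
  assumes e: "orthonormal_on UNIV e" and f: "orthonormal_on UNIV f"
    and s: "\<And>k. \<forall>n. \<bar>s k n\<bar> \<le> K k"
  shows "diag_op (\<lambda>n. \<Sum>k<m. c k * s k n) e f = (\<Sum>k<m. cscale_op (complex_of_real (c k)) (diag_op (s k) e f))"
proof (rule diag_op_eqI[OF e f])
  show "\<forall>n. \<bar>\<Sum>k<m. c k * s k n\<bar> \<le> (\<Sum>k<m. \<bar>c k\<bar> * K k)"
    using s by (auto simp: abs_mult intro!: order_trans[OF sum_abs] sum_mono mult_left_mono)
  fix x
  have "(\<lambda>n. \<Sum>k<m. complex_of_real (c k) *\<^sub>C (complex_of_real (s k n) * cinner x (e n)) *\<^sub>C f n) sums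
      (\<Sum>k<m. complex_of_real (c k) *\<^sub>C diag_op (s k) e f x)"
    by (intro sums_sum bounded_linear.sums[OF bounded_linear_scaleC_right] diag_op_series(1)[OF e f s])
  moreover have "(complex_of_real (\<Sum>k<m. c k * s k n) * cinner x (e n)) *\<^sub>C f n =
      (\<Sum>k<m. complex_of_real (c k) *\<^sub>C (complex_of_real (s k n) * cinner x (e n)) *\<^sub>C f n)" for n
    by (simp add: scaleC_scaleC sum_distrib_right mult.assoc flip: complex_vector.scale_sum_left)
  ultimately show "(\<lambda>n. (complex_of_real (\<Sum>k<m. c k * s k n) * cinner x (e n)) *\<^sub>C f n) sums
      (\<Sum>k<m. cscale_op (complex_of_real (c k)) (diag_op (s k) e f)) x"
    by (simp add: blinfun.sum_left)
qed

text \<open>The operator norm of a diagonal operator is at most the supremum of its coefficients, so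
  uniform convergence of coefficients suffices.\<close>

lemma diag_op_tendsto:
  fixes e f :: "nat \<Rightarrow> 'a::complex_hilbert_space"
  assumes e: "orthonormal_on UNIV e" and f: "orthonormal_on UNIV f"
    and s: "\<And>m. \<forall>n. \<bar>s m n\<bar> \<le> K m" and t: "\<forall>n. \<bar>t n\<bar> \<le> M"
    and d: "\<And>m n. \<bar>s m n - t n\<bar> \<le> d m" "d \<longlonglongrightarrow> 0"
  shows "(\<lambda>m. diag_op (s m) e f) \<longlonglongrightarrow> diag_op t e f"
proof -
  have "norm (diag_op (s m) e f - diag_op t e f) \<le> d m" for m
  proof (rule norm_blinfun_bound)
    have b: "\<forall>n. \<bar>s m n - t n\<bar> \<le> d m" using d(1) by blast
    then show "0 \<le> d m" by (meson abs_ge_zero order_trans)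
    show "norm ((diag_op (s m) e f - diag_op t e f) x) \<le> d m * norm x" for x
      using diag_op_series(3)[OF e f b] by (simp add: diag_op_diff[OF e f s t])
  qed
  then have "(\<lambda>m. diag_op (s m) e f - diag_op t e f) \<longlonglongrightarrow> 0"
    by (intro Lim_null_comparison[OF _ d(2)]) auto
  then show ?thesis by (rule LIM_zero_cancel)
qed


section \<open>Countable bounds in Banach ideals\<close>

lemma symmetric_norm_minus_commute:
  assumes I: "two_sided_ideal I" and N: "symmetric_norm_on I N" and "X \<in> I" "Y \<in> I"
  shows "N (X - Y) = N (Y - X)"
proof -
  have "N (cscale_op (- 1) (Y - X)) = cmod (- 1) * N (Y - X)"
    using N ideal_diff[OF I assms(4,3)] unfolding symmetric_norm_on_def by blast
  then show ?thesis by (simp add: cscale_op_minus_one)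
qed

lemma symmetric_norm_sum:
  assumes I: "two_sided_ideal I" and N: "symmetric_norm_on I N" and "finite A" "\<And>k. k \<in> A \<Longrightarrow> F k \<in> I"
  shows "N (\<Sum>k\<in>A. F k) \<le> (\<Sum>k\<in>A. N (F k))"
  using assms(3,4)
proof (induction A rule: finite_induct)
  case empty
  have "0 \<in> I" using I by (simp add: two_sided_ideal_def)
  then have "N 0 = 0" using N by (simp add: symmetric_norm_on_def)
  then show ?case by simp
next
  case (insert a A)
  have "N (F a + (\<Sum>k\<in>A. F k)) \<le> N (F a) + N (\<Sum>k\<in>A. F k)"
    using N insert.prems ideal_sum[OF I, of A F] by (simp add: symmetric_norm_on_def)
  also have "N (\<Sum>k\<in>A. F k) \<le> (\<Sum>k\<in>A. N (F k))" using insert by simp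
  finally show ?case using insert.hyps by simp
qed

text \<open>The normalised sum of countably many diagonal operators converges in the Banach ideal; its
  limit is again diagonal because the symmetric norm controls the operator norm.\<close>

lemma banach_ideal_countable_bound:
  fixes J :: "('a::complex_hilbert_space \<Rightarrow>\<^sub>L 'a) set" and \<xi> :: "nat \<Rightarrow> nat \<Rightarrow> real"
  assumes inf: "\<not> (\<exists>B :: 'a set. finite B \<and> complex_vector.span B = UNIV)"
    and J: "banach_ideal J" and \<xi>: "\<And>k. \<xi> k \<in> characteristic_set J"
  obtains \<eta> C where "\<eta> \<in> characteristic_set J" "\<forall>k. C k > 0" "\<forall>k n. \<xi> k n \<le> C k * \<eta> n"
proof -
  from J obtain N where op: "op_ideal J" and N: "symmetric_norm_on J N" and compl: "norm_complete_on J N"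
    by (auto simp: banach_ideal_def)
  have ideal: "two_sided_ideal J" and cpt: "\<And>X. X \<in> J \<Longrightarrow> compact_op X"
    using op by (auto simp: op_ideal_def)
  have N_nonneg: "N X \<ge> 0" if "X \<in> J" for X using N that by (simp add: symmetric_norm_on_def)
  have N_add: "N (X + Y) \<le> N X + N Y" if "X \<in> J" "Y \<in> J" for X Y
    using N that by (simp add: symmetric_norm_on_def)
  obtain K where K: "\<forall>Y\<in>J. norm Y \<le> K * N Y"
    by (rule symmetric_norm_dominates[OF op N])
  obtain b :: "nat \<Rightarrow> 'a" where b: "orthonormal_on UNIV b"
    by (rule orthonormal_seq_exists[OF inf])
  \<comment> \<open>All operators are moved to the single sequence \<open>b\<close>, so that adding
    operators means adding coefficient sequences.\<close>
  have mem: "\<xi> k \<in> c0_star \<and> diag_op (\<xi> k) b b \<in> J" for k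
  proof -
    from \<xi>[of k] obtain X where X: "X \<in> J" "\<xi> k = s_numbers X" by (auto simp: characteristic_set_def)
    obtain e f where *: "s_numbers X \<in> c0_star" "orthonormal_on UNIV e" "orthonormal_on UNIV f"
      "X = diag_op (s_numbers X) e f"
      by (rule compact_op_s_numbers[OF inf cpt[OF X(1)]])
    have "diag_op (\<xi> k) e f \<in> J" using * X by simp
    then have "diag_op (\<xi> k) b b \<in> J"
      by (rule ideal_diag_op_dominated[OF ideal _ *(2,3) b b, where C = 1])
        (use c0_star_bound[OF *(1)] X in auto)
    with * X show ?thesis by simp
  qed
  then have c0: "\<xi> k \<in> c0_star" and D: "diag_op (\<xi> k) b b \<in> J" for k by auto
  have \<xi>_nonneg: "\<xi> k n \<ge> 0" for k n using c0 by (simp add: c0_star_def)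
  \<comment> \<open>The power of 1/2 makes the norms of the summands summable; the 1 in the
    denominator covers \<open>\<xi> k\<close> = 0.\<close>
  define c where "c k = (1/2) ^ k / (1 + N (diag_op (\<xi> k) b b))" for k
  have c: "c k > 0" for k using N_nonneg[OF D] by (simp add: c_def add_pos_nonneg)
  define F where "F k = cscale_op (complex_of_real (c k)) (diag_op (\<xi> k) b b)" for k
  have F: "F k \<in> J" for k unfolding F_def by (rule ideal_cscale_op[OF ideal D])
  have NF: "N (F k) \<le> (1/2) ^ k" for k
  proof -
    have "N (F k) = c k * N (diag_op (\<xi> k) b b)"
      using N D c[of k] by (simp add: F_def symmetric_norm_on_def)
    also have "\<dots> = (1/2) ^ k * (N (diag_op (\<xi> k) b b) / (1 + N (diag_op (\<xi> k) b b)))"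
      by (simp add: c_def)
    also have "\<dots> \<le> (1/2) ^ k"
      using N_nonneg[OF D[of k]] by (intro mult_left_le) (simp_all add: divide_le_eq)
    finally show ?thesis .
  qed
  define \<sigma> where "\<sigma> m = (\<Sum>k<m. F k)" for m
  have \<sigma>: "\<sigma> m \<in> J" for m unfolding \<sigma>_def by (rule ideal_sum[OF ideal F])
  have tail: "N (\<sigma> m - \<sigma> M) \<le> 2 * (1/2) ^ M" if "m \<ge> M" for m M
  proof -
    have "\<sigma> m - \<sigma> M = (\<Sum>k=M..<m. F k)"
      using that unfolding \<sigma>_def by (simp add: sum_diff_nat_ivl lessThan_atLeast0)
    also have "N \<dots> \<le> (\<Sum>k=M..<m. N (F k))" by (rule symmetric_norm_sum[OF ideal N]) (auto intro: F)
    also have "\<dots> \<le> (\<Sum>k=M..<m. (1/2) ^ k)" by (intro sum_mono NF)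
    also have "\<dots> = 2 * (1/2) ^ M - 2 * (1/2) ^ m"
      using that by (induction m rule: dec_induct) simp_all
    also have "\<dots> \<le> 2 * (1/2) ^ M" by simp
    finally show ?thesis .
  qed
  have "\<exists>X\<in>J. (\<lambda>n. N (\<sigma> n - X)) \<longlonglongrightarrow> 0"
  proof (rule compl[unfolded norm_complete_on_def, rule_format], intro conjI allI impI)
    show "range \<sigma> \<subseteq> J" using \<sigma> by auto
    fix e :: real assume "e > 0"
    \<comment> \<open>Two tails are compared, each at most 2 (1/2)^M.\<close>
    then obtain M where M: "(1/2) ^ M < e / 4" using real_arch_pow_inv[of "e / 4" "1/2"] by auto
    show "\<exists>M. \<forall>m\<ge>M. \<forall>n\<ge>M. N (\<sigma> m - \<sigma> n) < e"
    proof (intro exI allI impI)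
      fix m n assume mn: "m \<ge> M" "n \<ge> M"
      have "N (\<sigma> m - \<sigma> n) \<le> N (\<sigma> m - \<sigma> M) + N (\<sigma> M - \<sigma> n)"
        using N_add[OF ideal_diff[OF ideal \<sigma> \<sigma>] ideal_diff[OF ideal \<sigma> \<sigma>], of m M M n] by simp
      also have "N (\<sigma> M - \<sigma> n) = N (\<sigma> n - \<sigma> M)"
        by (rule symmetric_norm_minus_commute[OF ideal N \<sigma> \<sigma>])
      finally show "N (\<sigma> m - \<sigma> n) < e" using tail[OF mn(1)] tail[OF mn(2)] M by linarith
    qed
  qed
  then obtain X where X: "X \<in> J" "(\<lambda>n. N (\<sigma> n - X)) \<longlonglongrightarrow> 0" by blast
  define d where "d m = norm (\<sigma> m - X)" for m
  have d_lim: "d \<longlonglongrightarrow> 0"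
  proof (rule Lim_null_comparison)
    show "\<forall>\<^sub>F m in sequentially. norm (d m) \<le> K * N (\<sigma> m - X)"
      using K ideal_diff[OF ideal \<sigma> X(1)] by (simp add: d_def)
    show "(\<lambda>m. K * N (\<sigma> m - X)) \<longlonglongrightarrow> 0" using tendsto_mult_right_zero[OF X(2)] .
  qed
  define \<eta>' where "\<eta>' m n = (\<Sum>k<m. c k * \<xi> k n)" for m n
  have \<sigma>_diag: "\<sigma> m = diag_op (\<eta>' m) b b" for m
    unfolding \<sigma>_def F_def \<eta>'_def by (rule diag_op_sum_scaled[OF b b c0_star_bound[OF c0], symmetric])
  have \<eta>'_c0: "\<eta>' m \<in> c0_star" for m
  proof -
    have "\<eta>' m \<longlonglongrightarrow> (\<Sum>k<m. c k * 0)"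
      unfolding \<eta>'_def[abs_def] by (intro tendsto_sum tendsto_mult tendsto_const) (use c0 in \<open>auto simp: c0_star_def\<close>)
    moreover have "decseq (\<eta>' m)"
      using c0 c less_imp_le[OF c]
      by (auto simp: \<eta>'_def decseq_def c0_star_def intro!: sum_mono mult_left_mono)
    ultimately show ?thesis
      using c \<xi>_nonneg by (auto simp: c0_star_def \<eta>'_def less_imp_le intro!: sum_nonneg)
  qed
  \<comment> \<open>Diagonal matrix entries of the limit, defined before \<open>X\<close> is known
    to be diagonal; \<open>dist\<close> bounds the coefficient error by \<open>d m\<close> uniformly
    in n.\<close>
  define \<eta> where "\<eta> n = Re (cinner (X (b n)) (b n))" for n
  have dist: "\<bar>\<eta>' m n - \<eta> n\<bar> \<le> d m" for m n
  proof -
    have nb: "norm (b n) = 1" using orthonormal_norm[OF b] by simp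
    have "\<eta>' m n - \<eta> n = Re (cinner ((\<sigma> m - X) (b n)) (b n))"
      using diag_op_basis[OF b b c0_star_bound[OF \<eta>'_c0], of m n]
      by (simp add: \<eta>_def \<sigma>_diag blinfun.diff_left cinner_diff_left cinner_scaleC_left cinner_self nb)
    also have "\<bar>\<dots>\<bar> \<le> cmod (cinner ((\<sigma> m - X) (b n)) (b n))" by (rule abs_Re_le_cmod)
    also have "\<dots> \<le> d m"
      using order_trans[OF cmod_cinner_le, of "(\<sigma> m - X) (b n)" "b n"] norm_blinfun[of "\<sigma> m - X" "b n"]
      by (simp add: d_def nb)
    finally show ?thesis .
  qed
  have \<eta>_lim: "(\<lambda>m. \<eta>' m n) \<longlonglongrightarrow> \<eta> n" for n
    by (rule LIM_zero_cancel, rule Lim_null_comparison[OF _ d_lim]) (simp add: dist)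
  have \<eta>: "\<eta> \<in> c0_star"
    unfolding c0_star_def
  proof (intro CollectI conjI allI)
    show "0 \<le> \<eta> n" for n
      by (rule LIMSEQ_le_const[OF \<eta>_lim]) (use \<eta>'_c0 in \<open>auto simp: c0_star_def\<close>)
    show "decseq \<eta>"
      unfolding decseq_def
      by (intro allI impI LIMSEQ_le[OF \<eta>_lim \<eta>_lim]) (use \<eta>'_c0 in \<open>auto simp: c0_star_def decseq_def\<close>)
    show "\<eta> \<longlonglongrightarrow> 0"
    proof (rule LIMSEQ_I)
      fix r :: real assume "r > 0"
      then have "eventually (\<lambda>m. d m < r / 2) sequentially"
        using d_lim by (intro order_tendstoD) auto
      then obtain m where m: "d m < r / 2" using eventually_happens by force
      have "\<eta>' m \<longlonglongrightarrow> 0" using \<eta>'_c0 by (simp add: c0_star_def)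
      then obtain n0 where n0: "\<And>n. n \<ge> n0 \<Longrightarrow> norm (\<eta>' m n - 0) < r / 2"
        using LIMSEQ_D[of "\<eta>' m" 0 "r / 2"] \<open>r > 0\<close> by auto
      have "norm (\<eta> n - 0) < r" if "n \<ge> n0" for n
        using n0[OF that] dist[of m n] m unfolding real_norm_def by linarith
      then show "\<exists>no. \<forall>n\<ge>no. norm (\<eta> n - 0) < r" by blast
    qed
  qed
  have "\<sigma> \<longlonglongrightarrow> diag_op \<eta> b b"
    using diag_op_tendsto[OF b b c0_star_bound[OF \<eta>'_c0] c0_star_bound[OF \<eta>] dist d_lim]
    by (simp add: \<sigma>_diag[abs_def])
  moreover have "\<sigma> \<longlonglongrightarrow> X"
    using d_lim unfolding d_def tendsto_norm_zero_iff by (rule LIM_zero_cancel)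
  ultimately have "X = diag_op \<eta> b b" using LIMSEQ_unique by blast
  then have "s_numbers X = \<eta>" using s_numbers_diag_op[OF b b \<eta>] by simp
  show thesis
  proof
    show "\<eta> \<in> characteristic_set J"
      using X(1) \<open>s_numbers X = \<eta>\<close> by (auto simp: characteristic_set_def)
    show "\<forall>k. 1 / c k > 0" using c by simp
    show "\<forall>k n. \<xi> k n \<le> 1 / c k * \<eta> n"
    proof (intro allI)
      fix k n
      \<comment> \<open>Every partial sum with more than \<open>k\<close> terms already contains
        this nonnegative term.\<close>
      have "c k * \<xi> k n \<le> \<eta> n"
      proof (rule LIMSEQ_le_const[OF \<eta>_lim], intro exI allI impI)
        fix m assume "m \<ge> Suc k"
        then show "c k * \<xi> k n \<le> \<eta>' m n"
          unfolding \<eta>'_def using c \<xi>_nonneg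
          by (intro member_le_sum[of k _ "\<lambda>k. c k * \<xi> k n"]) (auto simp: less_imp_le)
      qed
      then show "\<xi> k n \<le> 1 / c k * \<eta> n" using c[of k] by (simp add: field_simps)
    qed
  qed
qed

text \<open>Monotonicity of the p-th power turns the bound with constants \<open>C k\<close> in the
  Banach ideal into a bound with constants \<open>C k powr p\<close> in \<open>I\<close>, and that
  is all that membership in the ideal of \<open>Y\<close> requires.\<close>

lemma e_complete_principal_between:
  fixes I J :: "('a::complex_hilbert_space \<Rightarrow>\<^sub>L 'a) set"
  assumes inf: "\<not> (\<exists>B :: 'a set. finite B \<and> complex_vector.span B = UNIV)"
    and I: "e_complete I" and J: "countably_generated_ideal J" and "J \<subseteq> I"
  obtains L where "principal_ideal L" "J \<subseteq> L" "L \<subseteq> I"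
proof -
  obtain J0 :: "('a \<Rightarrow>\<^sub>L 'a) set" and p where J0: "banach_ideal J0" and p: "p > 0" and opI: "op_ideal I"
    and char: "characteristic_set I = (\<lambda>\<xi> n. \<xi> n powr p) ` characteristic_set J0"
    using I unfolding e_complete_def is_ideal_power_def by blast
  obtain S where opJ: "op_ideal J" and S: "S \<subseteq> BH" "countable S" "J = two_sided_ideal hull S"
    using J by (auto simp: countably_generated_ideal_def)
  have idealI: "two_sided_ideal I" and cpt: "\<And>X. X \<in> I \<Longrightarrow> compact_op X"
    using opI by (auto simp: op_ideal_def)
  have "S \<subseteq> J" unfolding S(3) by (rule hull_subset)
  obtain Z where Z: "Z \<in> J" "Z \<noteq> 0" by (rule op_ideal_nonzero[OF opJ])
  \<comment> \<open>Adding a nonzero \<open>Z\<close> makes the enumerated set visibly nonempty and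
    later witnesses that \<open>L\<close> is not the zero ideal.\<close>
  define X where "X = from_nat_into (insert Z S)"
  have range_X: "range X = insert Z S" unfolding X_def by (rule range_from_nat_into) (use S in auto)
  have XI: "X k \<in> I" for k
    using range_X \<open>S \<subseteq> J\<close> \<open>J \<subseteq> I\<close> Z by (metis insert_subset range_subsetD subset_trans)
  have "\<exists>\<xi>\<in>characteristic_set J0. s_numbers (X k) = (\<lambda>n. \<xi> n powr p)" for k
    using XI[of k] char unfolding characteristic_set_def by blast
  then obtain \<xi> where \<xi>: "\<xi> k \<in> characteristic_set J0" "s_numbers (X k) = (\<lambda>n. \<xi> k n powr p)" for k
    by metis
  obtain \<eta> C where \<eta>: "\<eta> \<in> characteristic_set J0" and C: "\<forall>k. C k > 0"
    and le: "\<forall>k n. \<xi> k n \<le> C k * \<eta> n"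
    by (rule banach_ideal_countable_bound[OF inf J0 \<xi>(1)])
  have nonneg: "\<zeta> n \<ge> 0" if mem: "\<zeta> \<in> characteristic_set J0" for \<zeta> n
  proof -
    obtain A where A: "A \<in> J0" "\<zeta> = s_numbers A" using mem by (auto simp: characteristic_set_def)
    then have "compact_op A" using J0 by (simp add: banach_ideal_def op_ideal_def)
    then have "s_numbers A \<in> c0_star" by (rule compact_op_s_numbers[OF inf])
    with A show ?thesis by (simp add: c0_star_def)
  qed
  have "(\<lambda>n. \<eta> n powr p) \<in> characteristic_set I" using \<eta> char by blast
  then obtain Y where Y: "Y \<in> I" "s_numbers Y = (\<lambda>n. \<eta> n powr p)"
    by (auto simp: characteristic_set_def)
  have YBH: "Y \<in> BH" using idealI Y by (auto simp: two_sided_ideal_def)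
  define L where "L = two_sided_ideal hull {Y}"
  have idealL: "two_sided_ideal L" unfolding L_def by (rule two_sided_ideal_hull) (use YBH in simp)
  have YL: "Y \<in> L" unfolding L_def by (rule hull_inc) simp
  have "L \<subseteq> I" unfolding L_def by (rule hull_minimal) (use Y idealI in auto)
  have XL: "X k \<in> L" for k
  proof (rule mem_ideal_if_s_numbers_le[OF inf idealL cpt[OF XI] cpt[OF Y(1)] YL])
    fix n
    have "\<xi> k n powr p \<le> (C k * \<eta> n) powr p"
      using nonneg[OF \<xi>(1)] le p by (intro powr_mono2) auto
    also have "\<dots> = C k powr p * \<eta> n powr p"
      using nonneg[OF \<eta>] C by (simp add: powr_mult)
    finally show "s_numbers (X k) n \<le> C k powr p * s_numbers Y n" by (simp add: \<xi> Y)
  qed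
  then have "insert Z S \<subseteq> L" unfolding range_X[symmetric] by (rule image_subsetI)
  then have "J \<subseteq> L" unfolding S(3) by (intro hull_minimal) (use idealL in auto)
  moreover have "op_ideal L"
    using idealL \<open>L \<subseteq> I\<close> cpt \<open>insert Z S \<subseteq> L\<close> Z by (auto simp: op_ideal_def)
  then have "principal_ideal L"
    using YBH by (auto simp: principal_ideal_def L_def)
  ultimately show thesis using that \<open>L \<subseteq> I\<close> by blast
qed

section \<open>Chains of principal ideals\<close>

text \<open>Each term is encoded by its lower Dedekind cut; the pairs of an index and a rational are
  countable, so a sequence becomes a set of naturals.\<close>

lemma real_sequences_lepoll_reals: "(UNIV :: (nat \<Rightarrow> real) set) \<lesssim> (UNIV :: real set)"
proof -
  define g :: "(nat \<Rightarrow> real) \<Rightarrow> nat set"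
    where "g f = to_nat ` {(n, q :: rat). of_rat q < f n}" for f
  have "f = f'" if "g f = g f'" for f f'
  proof (rule ext, rule ccontr)
    have "{(n, q :: rat). of_rat q < f n} = {(n, q). of_rat q < f' n}"
      using that unfolding g_def by (simp only: inj_image_eq_iff[OF inj_to_nat])
    then have *: "of_rat q < f n \<longleftrightarrow> of_rat q < f' n" for n and q :: rat
      unfolding set_eq_iff by (metis case_prod_conv mem_Collect_eq)
    fix n assume "f n \<noteq> f' n"
    then consider "f n < f' n" | "f' n < f n" by linarith
    then show False
    proof cases
      case 1
      from of_rat_dense[OF this] obtain q :: rat where "f n < of_rat q" "of_rat q < f' n" by blast
      with * show False by (meson less_asym)
    next
      case 2
      from of_rat_dense[OF this] obtain q :: rat where "f' n < of_rat q" "of_rat q < f n" by blast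
      with * show False by (meson less_asym)
    qed
  qed
  then have "inj g" by (rule injI)
  then have "(UNIV :: (nat \<Rightarrow> real) set) \<lesssim> (UNIV :: nat set set)"
    unfolding lepoll_def by blast
  then show ?thesis using nat_sets_eqpoll_reals lepoll_trans2 by blast
qed

text \<open>\<open>card_of S\<close> is a well-order of \<open>S\<close> of least length, so its
  proper initial segments have strictly smaller cardinality than \<open>S\<close>. An uncountable
  one would embed in the reals and have the size of the continuum, hence be at least as large as
  \<open>S\<close>.\<close>

lemma continuum_hypothesis_countable_underS:
  assumes CH: continuum_hypothesis and S: "S \<lesssim> (UNIV :: real set)" and x: "x \<in> S"
  shows "countable (Order_Relation.underS (card_of S) x)"
proof (rule ccontr)
  define U where "U = Order_Relation.underS (card_of S) x"
  assume "\<not> countable (Order_Relation.underS (card_of S) x)"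
  then have unc: "\<not> countable U" by (simp add: U_def)
  have "x \<in> Field (card_of S)" using x by (simp add: Field_card_of)
  from card_of_underS[OF card_of_Card_order this]
  have less: "(card_of U, card_of S) \<in> ordLess" by (simp add: U_def)
  have "U \<subseteq> Field (card_of S)" by (auto simp: U_def Order_Relation.underS_def Field_def)
  then have "U \<subseteq> S" by (simp add: Field_card_of)
  obtain h where h: "inj_on h S" "h ` S \<subseteq> (UNIV :: real set)" using S by (auto simp: lepoll_def)
  have inj: "inj_on h U" using h(1) \<open>U \<subseteq> S\<close> inj_on_subset by blast
  then have "\<not> countable (h ` U)" using unc countable_image_inj_on by blast
  then have "h ` U \<approx> (UNIV :: real set)" using CH by (auto simp: continuum_hypothesis_def)
  then have "S \<lesssim> U"
    using S inj_on_image_eqpoll_self[OF inj]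
    by (meson eqpoll_sym eqpoll_trans lepoll_trans2)
  then have "(card_of S, card_of U) \<in> ordLeq"
    using card_of_ordLeq by (auto simp: lepoll_def)
  with less show False using not_ordLess_ordLeq by blast
qed

text \<open>Transfinite recursion along a well-order all of whose proper initial segments are countable:
  the value at \<open>x\<close> is an upper bound of \<open>x\<close> and of all earlier values.\<close>

lemma continuum_hypothesis_cofinal_chain:
  fixes S :: "'a set set"
  assumes CH: continuum_hypothesis and S: "S \<lesssim> (UNIV :: real set)"
    and ub: "\<And>A. A \<subseteq> S \<Longrightarrow> countable A \<Longrightarrow> \<exists>U\<in>S. \<forall>a\<in>A. a \<subseteq> U"
  obtains \<C> where "\<C> \<subseteq> S" "chain\<^sub>\<subseteq> \<C>" "\<Union>\<C> = \<Union>S"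
proof -
  define r where "r = card_of S"
  have wo: "Well_order r" unfolding r_def by (rule card_of_Well_order)
  have field: "Field r = S" by (simp add: r_def Field_card_of)
  have wf: "wf (r - Id)" using wo by (simp add: well_order_on_def)
  \<comment> \<open>Vacuous outside \<open>S\<close>, because the recursion runs over the whole
    type.\<close>
  define P where "P f x U \<longleftrightarrow> (x \<in> S \<longrightarrow> U \<in> S \<and> x \<subseteq> U \<and> (\<forall>y. (y, x) \<in> r - Id \<longrightarrow> f y \<subseteq> U))"
    for f x U
  have "\<exists>f. \<forall>x. P f x (f x)"
  proof (rule dependent_wf_choice[OF wf])
    fix U x and f g :: "'a set \<Rightarrow> 'a set" assume "\<And>y. (y, x) \<in> r - Id \<Longrightarrow> f y = g y"
    then show "P f x U = P g x U" by (simp add: P_def)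
  next
    fix x and f :: "'a set \<Rightarrow> 'a set" assume hist: "\<And>y. (y, x) \<in> r - Id \<Longrightarrow> P f y (f y)"
    show "\<exists>U. P f x U"
    proof (cases "x \<in> S")
      case True
      define D where "D = Order_Relation.underS r x"
      have mem: "y \<in> D \<longleftrightarrow> (y, x) \<in> r - Id" for y by (auto simp: D_def Order_Relation.underS_def)
      have "D \<subseteq> S" unfolding field[symmetric] by (auto simp: mem Field_def)
      then have "insert x (f ` D) \<subseteq> S" using hist True by (auto simp: mem P_def)
      moreover have "countable (insert x (f ` D))"
        using continuum_hypothesis_countable_underS[OF CH S True] by (simp add: D_def r_def)
      ultimately have "\<exists>U\<in>S. \<forall>a\<in>insert x (f ` D). a \<subseteq> U" by (rule ub)
      then obtain U where "U \<in> S" "\<forall>a\<in>insert x (f ` D). a \<subseteq> U" by (elim bexE)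
      then have "P f x U" unfolding P_def mem[symmetric] by simp
      then show ?thesis by blast
    qed (simp add: P_def)
  qed
  then obtain f where f: "\<And>x. P f x (f x)" by blast
  show thesis
  proof
    show sub: "f ` S \<subseteq> S" using f by (auto simp: P_def)
    show "chain\<^sub>\<subseteq> (f ` S)"
      unfolding chain_subset_def
    proof (intro ballI)
      fix U V assume "U \<in> f ` S" "V \<in> f ` S"
      then obtain x y where xy: "x \<in> S" "y \<in> S" "U = f x" "V = f y" by blast
      \<comment> \<open>Of two distinct indices one precedes the other, and the value at the later
        one contains the value at the earlier.\<close>
      have "x = y \<or> (x, y) \<in> r - Id \<or> (y, x) \<in> r - Id"
        using wo xy field by (auto simp: well_order_on_def linear_order_on_def total_on_def)
      then show "U \<subseteq> V \<or> V \<subseteq> U" using f xy by (auto simp: P_def)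
    qed
    show "\<Union> (f ` S) = \<Union> S"
    proof
      show "\<Union> (f ` S) \<subseteq> \<Union> S" using sub by blast
      show "\<Union> S \<subseteq> \<Union> (f ` S)" using f by (force simp: P_def)
    qed
  qed
qed

text \<open>A generator and the diagonal operator of its singular values along a fixed
  \<open>b\<close> lie in each other's ideals, so real sequences parametrise all principal
  ideals.\<close>

lemma principal_ideals_lepoll_reals:
  assumes inf: "\<not> (\<exists>B :: 'a::complex_hilbert_space set. finite B \<and> complex_vector.span B = UNIV)"
  shows "{L :: ('a \<Rightarrow>\<^sub>L 'a) set. principal_ideal L} \<lesssim> (UNIV :: real set)"
proof -
  obtain b :: "nat \<Rightarrow> 'a" where b: "orthonormal_on UNIV b"
    by (rule orthonormal_seq_exists[OF inf])
  have ex: "\<exists>s. L = two_sided_ideal hull {diag_op s b b}" if L: "principal_ideal L" for L :: "('a \<Rightarrow>\<^sub>L 'a) set"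
  proof -
    obtain X where X: "X \<in> BH" "L = two_sided_ideal hull {X}" and op: "op_ideal L"
      using L by (auto simp: principal_ideal_def)
    have XL: "X \<in> L" unfolding X(2) by (rule hull_inc) simp
    have "compact_op X" using op XL by (simp add: op_ideal_def)
    then obtain s e f where svd: "s \<in> c0_star" "orthonormal_on UNIV e" "orthonormal_on UNIV f"
      "X = diag_op s e f"
      by (rule compact_op_svd[OF inf])
    note bd = c0_star_bound[OF svd(1)]
    define M where "M = two_sided_ideal hull {diag_op s b b}"
    have idealM: "two_sided_ideal M"
      unfolding M_def by (rule two_sided_ideal_hull) (use diag_op_series(4)[OF b b bd] in simp)
    have idealL: "two_sided_ideal L" using op by (simp add: op_ideal_def)
    have "diag_op s e f \<in> L" using XL svd by simp
    then have "diag_op s b b \<in> L"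
      by (rule ideal_diag_op_dominated[OF idealL _ svd(2,3) b b bd, where C = 1]) simp
    then have "M \<subseteq> L" unfolding M_def by (intro hull_minimal) (use idealL in auto)
    have "diag_op s b b \<in> M" unfolding M_def by (rule hull_inc) simp
    then have "diag_op s e f \<in> M"
      by (rule ideal_diag_op_dominated[OF idealM _ b b svd(2,3) bd, where C = 1]) simp
    then have "L \<subseteq> M" unfolding X(2) by (intro hull_minimal) (use idealM svd in auto)
    with \<open>M \<subseteq> L\<close> show ?thesis unfolding M_def by blast
  qed
  then have "{L. principal_ideal L} \<subseteq> range (\<lambda>s. two_sided_ideal hull {diag_op s b b})" by blast
  then have "{L :: ('a \<Rightarrow>\<^sub>L 'a) set. principal_ideal L} \<lesssim> (UNIV :: (nat \<Rightarrow> real) set)"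
    by (meson image_lepoll lepoll_trans subset_imp_lepoll)
  then show ?thesis using real_sequences_lepoll_reals lepoll_trans by blast
qed

lemma principal_ideal_hull:
  assumes "op_ideal I" "X \<in> I" "X \<noteq> 0"
  shows "principal_ideal (two_sided_ideal hull {X})" "two_sided_ideal hull {X} \<subseteq> I"
  using op_ideal_hull[OF assms(1) _ _ assms(3), of "{X}"] assms
  by (auto simp: principal_ideal_def op_ideal_def two_sided_ideal_def)

lemma e_complete_union_of_chain:
  fixes I :: "('a::complex_hilbert_space \<Rightarrow>\<^sub>L 'a) set"
  assumes inf: "\<not> (\<exists>B :: 'a set. finite B \<and> complex_vector.span B = UNIV)"
    and CH: continuum_hypothesis and I: "e_complete I"
  shows "\<exists>\<C>. (\<forall>L\<in>\<C>. principal_ideal L) \<and> chain\<^sub>\<subseteq> \<C> \<and> I = \<Union>\<C>"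
proof -
  have op: "op_ideal I" using I by (auto simp: e_complete_def is_ideal_power_def)
  then have BH: "I \<subseteq> BH" by (simp add: op_ideal_def two_sided_ideal_def)
  obtain Z where Z: "Z \<in> I" "Z \<noteq> 0" by (rule op_ideal_nonzero[OF op])
  define S where "S = {L. principal_ideal L \<and> L \<subseteq> I}"
  have small: "S \<lesssim> (UNIV :: real set)"
    by (rule lepoll_trans[OF subset_imp_lepoll principal_ideals_lepoll_reals[OF inf]]) (auto simp: S_def)
  have ub: "\<exists>U\<in>S. \<forall>a\<in>A. a \<subseteq> U" if A: "A \<subseteq> S" "countable A" for A
  proof -
    have "\<forall>L\<in>A. \<exists>X. L = two_sided_ideal hull {X}" using A by (auto simp: S_def principal_ideal_def)
    then obtain x where x: "\<And>L. L \<in> A \<Longrightarrow> L = two_sided_ideal hull {x L}" by metis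
    have xL: "x L \<in> L" if "L \<in> A" for L
      using hull_inc[of "x L" "{x L}" two_sided_ideal] x[OF that] by simp
    \<comment> \<open>\<open>Z\<close> takes care of an empty \<open>A\<close>: the generated ideal
      must be nonzero.\<close>
    define T where "T = insert Z (x ` A)"
    have T: "T \<subseteq> I" using Z xL A by (auto simp: T_def S_def)
    note J = op_ideal_hull[OF op T _ Z(2)]
    have "countably_generated_ideal (two_sided_ideal hull T)"
      unfolding countably_generated_ideal_def using J(1) T BH A(2)
      by (intro conjI exI[of _ T]) (auto simp: T_def)
    moreover have "two_sided_ideal hull T \<subseteq> I" using J(2) by (simp add: T_def)
    ultimately obtain L where L: "principal_ideal L" "two_sided_ideal hull T \<subseteq> L" "L \<subseteq> I"
      by (rule e_complete_principal_between[OF inf I])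
    have "a \<subseteq> L" if "a \<in> A" for a
    proof -
      have "{x a} \<subseteq> T" using that by (simp add: T_def)
      then have "two_sided_ideal hull {x a} \<subseteq> two_sided_ideal hull T" by (rule hull_mono)
      with x[OF that] L(2) show ?thesis by blast
    qed
    with L show ?thesis by (intro bexI[of _ L]) (simp_all add: S_def)
  qed
  obtain \<C> where \<C>: "\<C> \<subseteq> S" "chain\<^sub>\<subseteq> \<C>" "\<Union>\<C> = \<Union>S"
    by (rule continuum_hypothesis_cofinal_chain[OF CH small ub])
  have "X \<in> \<Union>S" if "X \<in> I" for X
  proof (cases "X = 0")
    \<comment> \<open>The zero operator generates only the zero ideal, which is not an
      \<open>op_ideal\<close>; it is found in the ideal of \<open>Z\<close>.\<close>
    case True
    have "two_sided_ideal hull {Z} \<in> S" using principal_ideal_hull[OF op Z] by (simp add: S_def)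
    moreover have "two_sided_ideal (two_sided_ideal hull {Z})"
      using two_sided_ideal_hull[of "{Z}"] Z BH by auto
    then have "0 \<in> two_sided_ideal hull {Z}" by (simp add: two_sided_ideal_def)
    ultimately show ?thesis using True by blast
  next
    case False
    then have "two_sided_ideal hull {X} \<in> S" using principal_ideal_hull[OF op that] by (simp add: S_def)
    moreover have "X \<in> two_sided_ideal hull {X}" by (rule hull_inc) simp
    ultimately show ?thesis by blast
  qed
  then have "I = \<Union>S" unfolding set_eq_iff by (auto simp: S_def)
  show ?thesis
  proof (intro exI conjI)
    show "\<forall>L\<in>\<C>. principal_ideal L" using \<C>(1) by (auto simp: S_def)
    show "chain\<^sub>\<subseteq> \<C>" by (rule \<C>(2))
    show "I = \<Union>\<C>" unfolding \<C>(3) by (rule \<open>I = \<Union>S\<close>)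
  qed
qed

theorem corollary4p5:
  assumes separable: "separable_space (euclidean :: 'a::complex_hilbert_space topology)"
    and infinite_dimensional: "\<not> (\<exists>B :: 'a set. finite B \<and> complex_vector.span B = UNIV)"
  shows "(\<forall>I J :: ('a \<Rightarrow>\<^sub>L 'a) set.
            e_complete I \<and> countably_generated_ideal J \<and> J \<subseteq> I \<longrightarrow>
            (\<exists>L. principal_ideal L \<and> J \<subseteq> L \<and> L \<subseteq> I)) \<and>
         (continuum_hypothesis \<longrightarrow>
          (\<forall>I :: ('a \<Rightarrow>\<^sub>L 'a) set. e_complete I \<longrightarrow>
            (\<exists>\<C>. (\<forall>L\<in>\<C>. principal_ideal L) \<and> chain\<^sub>\<subseteq> \<C> \<and> I = \<Union>\<C>)))"
  by (intro conjI allI impI)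
    (meson e_complete_principal_between[OF infinite_dimensional],
     rule e_complete_union_of_chain[OF infinite_dimensional])

end
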